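(* Let $A \in M_n$ be a normal matrix with eigenvalues $\lambda_1, \dots, \lambda_n$ (listed with multiplicity), and let $k$ be an integer with $1 \le k \le n$. Then $$\Lambda_k(A) = \bigcap_{1 \le j_1 < \cdots < j_{n-k+1} \le n} \operatorname{conv}\{\lambda_{j_1}, \dots, \lambda_{j_{n-k+1}}\},$$ where the intersection is over all choices of $n-k+1$ indices from $\{1,\dots,n\}$.
   Context: $M_n$ is the algebra of $n\times n$ complex matrices, and $\operatorname{conv}$ denotes the convex hull in $\mathbb{C}$. The rank-$k$ numerical range of $A \in M_n$ is $$\Lambda_k(A) = \{\lambda \in \mathbb{C} : PAP = \lambda P \text{ for some rank-}k \text{ orthogonal projection } P \in M_n\}.$$ *)

theory Defs
  imports
    "Jordan_Normal_Form.Schur_Decomposition"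
    "Jordan_Normal_Form.DL_Rank"
    "HOL-Analysis.Convex"
begin

definition normal_mat :: "complex mat \<Rightarrow> bool" where
  "normal_mat A \<longleftrightarrow> A * mat_adjoint A = mat_adjoint A * A"

definition orthogonal_projection :: "nat \<Rightarrow> complex mat \<Rightarrow> bool" where
  "orthogonal_projection n P \<longleftrightarrow>
     P \<in> carrier_mat n n \<and> P * P = P \<and> mat_adjoint P = P"

text \<open>Meaningful for square \<open>A\<close> only; the ambient dimension is read off from \<open>A\<close>.\<close>

definition rank_numerical_range :: "nat \<Rightarrow> complex mat \<Rightarrow> complex set" where
  "rank_numerical_range k A =
     {\<mu>. \<exists>P. orthogonal_projection (dim_row A) P \<and> vec_space.rank (dim_row A) P = k \<and>
             P * A * P = \<mu> \<cdot>\<^sub>m P}"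

end

theory Submission
  imports Defs
begin

text \<open>
  After unitary diagonalization, \<open>\<mu> \<in> \<Lambda>\<^sub>k(A)\<close> means that the diagonal form with entries
  \<open>\<lambda>\<^sub>j - \<mu>\<close> has a \<open>k\<close>-dimensional totally isotropic subspace. Such a subspace meets the
  coordinate subspace of any \<open>n - k + 1\<close> indices, and a common nonzero vector exhibits \<open>0\<close> as a convex
  combination of the corresponding entries.

  Conversely, if \<open>0\<close> lies in all these hulls, every closed half-plane at \<open>0\<close> contains at least \<open>k\<close>
  entries. Zero entries and antipodal pairs each split off one dimension. After a rotation the
  remaining entries are \<open>\<plusminus>r (t + \<i>)\<close> with \<open>r > 0\<close>; sorted by \<open>t\<close>, they are partitioned greedily into
  chains along which the sign alternates, and a count based on the half-plane condition gives
  \<open>\<Sum> \<lfloor>(|chain| - 1) / 2\<rfloor> \<ge> k\<close>. For a chain with nodes \<open>t\<^sub>1 < \<dots> < t\<^sub>m\<close> and \<open>\<omega>(t) = \<Prod> (t - t\<^sub>j)\<close> the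
  numbers \<open>1 / \<omega>'(t\<^sub>j)\<close> also alternate in sign, so rescaling the coordinates turns the form into
  \<open>\<Sum> (t\<^sub>j + \<i>) \<bar>f(t\<^sub>j)\<bar>\<^sup>2 / \<omega>'(t\<^sub>j)\<close>, which by Lagrange interpolation vanishes on polynomials \<open>f\<close>
  of degree below \<open>\<lfloor>(m - 1) / 2\<rfloor>\<close>.
\<close>

section \<open>Totally isotropic families for diagonal forms\<close>

definition isotropic :: "'i set \<Rightarrow> ('i \<Rightarrow> complex) \<Rightarrow> nat \<Rightarrow> bool" where
  "isotropic I \<mu> k \<longleftrightarrow> (\<exists>x :: nat \<Rightarrow> 'i \<Rightarrow> complex.
     (\<forall>a<k. \<forall>b<k. (\<Sum>i\<in>I. \<mu> i * cnj (x a i) * x b i) = 0) \<and>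
     (\<forall>c. (\<forall>i\<in>I. (\<Sum>a<k. c a * x a i) = 0) \<longrightarrow> (\<forall>a<k. c a = 0)))"

lemma isotropicI:
  assumes "\<And>a b. a < k \<Longrightarrow> b < k \<Longrightarrow> (\<Sum>i\<in>I. \<mu> i * cnj (x a i) * x b i) = 0"
    and "\<And>c a. (\<And>i. i \<in> I \<Longrightarrow> (\<Sum>a<k. c a * x a i) = 0) \<Longrightarrow> a < k \<Longrightarrow> c a = 0"
  shows "isotropic I \<mu> k"
  unfolding isotropic_def using assms by (intro exI[of _ x] conjI allI impI) simp_all

lemma isotropic_0: "isotropic I \<mu> 0"
  by (rule isotropicI) auto

lemma isotropic_mono:
  assumes "isotropic I \<mu> k" and "m \<le> k"
  shows "isotropic I \<mu> m"
proof -
  obtain x where x: "\<forall>a<k. \<forall>b<k. (\<Sum>i\<in>I. \<mu> i * cnj (x a i) * x b i) = 0"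
    and li: "\<forall>c. (\<forall>i\<in>I. (\<Sum>a<k. c a * x a i) = 0) \<longrightarrow> (\<forall>a<k. c a = 0)"
    using assms(1) unfolding isotropic_def by blast
  show ?thesis
  proof (rule isotropicI[where x = x])
    fix a b assume "a < m" "b < m"
    then show "(\<Sum>i\<in>I. \<mu> i * cnj (x a i) * x b i) = 0"
      using x assms(2) by simp
  next
    fix c :: "nat \<Rightarrow> complex" and a
    assume c: "\<And>i. i \<in> I \<Longrightarrow> (\<Sum>a<m. c a * x a i) = 0" and a: "a < m"
    have "(\<Sum>a<k. (if a < m then c a else 0) * x a i) = (\<Sum>a<m. c a * x a i)" for i
      by (rule sum.mono_neutral_cong_right) (use assms(2) in auto)
    with li[rule_format, of "\<lambda>a. if a < m then c a else 0" a] c a assms(2)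
    show "c a = 0" by simp
  qed
qed

lemma isotropic_scale:
  assumes "isotropic I (\<lambda>i. w * \<mu> i) k" and "w \<noteq> 0"
  shows "isotropic I \<mu> k"
proof -
  have "(\<Sum>i\<in>I. w * \<mu> i * cnj (x a i) * x b i) = w * (\<Sum>i\<in>I. \<mu> i * cnj (x a i) * x b i)"
    for x :: "nat \<Rightarrow> 'a \<Rightarrow> complex" and a b
    by (simp add: sum_distrib_left mult_ac)
  with assms show ?thesis unfolding isotropic_def by simp
qed

lemma isotropic_Un:
  assumes "isotropic I \<mu> k" and "isotropic J \<mu> m"
    and fin: "finite I" "finite J" and disj: "I \<inter> J = {}"
  shows "isotropic (I \<union> J) \<mu> (k + m)"
proof -
  obtain x where x: "\<forall>a<k. \<forall>b<k. (\<Sum>i\<in>I. \<mu> i * cnj (x a i) * x b i) = 0"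
    and xli: "\<forall>c. (\<forall>i\<in>I. (\<Sum>a<k. c a * x a i) = 0) \<longrightarrow> (\<forall>a<k. c a = 0)"
    using assms(1) unfolding isotropic_def by blast
  obtain y where y: "\<forall>a<m. \<forall>b<m. (\<Sum>i\<in>J. \<mu> i * cnj (y a i) * y b i) = 0"
    and yli: "\<forall>c. (\<forall>i\<in>J. (\<Sum>a<m. c a * y a i) = 0) \<longrightarrow> (\<forall>a<m. c a = 0)"
    using assms(2) unfolding isotropic_def by blast
  define z where "z = (\<lambda>a i. if a < k then if i \<in> I then x a i else 0
    else if i \<in> J then y (a - k) i else 0)"
  have notJ: "i \<notin> J" if "i \<in> I" for i using that disj by auto
  have notI: "i \<notin> I" if "i \<in> J" for i using that disj by auto
  have split: "sum f (I \<union> J) = sum f I + sum f J" for f :: "'a \<Rightarrow> complex"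
    by (rule sum.union_disjoint[OF fin disj])
  have splitk: "sum f {..<k+m} = sum f {..<k} + (\<Sum>a<m. f (k + a))" for f :: "nat \<Rightarrow> complex"
    by (induction m) (simp_all add: add.assoc)
  show ?thesis
  proof (rule isotropicI[where x = z])
    fix a b assume ab: "a < k + m" "b < k + m"
    show "(\<Sum>i\<in>I \<union> J. \<mu> i * cnj (z a i) * z b i) = 0"
    proof (cases "a < k \<longleftrightarrow> b < k")
      case True
      then show ?thesis
      proof (cases "a < k")
        case True
        with \<open>a < k \<longleftrightarrow> b < k\<close> x[rule_format, of a b] show ?thesis
          by (simp add: split z_def notI)
      next
        case False
        with \<open>a < k \<longleftrightarrow> b < k\<close> ab y[rule_format, of "a - k" "b - k"] show ?thesis
          by (simp add: split z_def notJ)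
      qed
    next
      case False
      then have "\<mu> i * cnj (z a i) * z b i = 0" if "i \<in> I \<union> J" for i
        using that by (auto simp: z_def notI notJ)
      then show ?thesis by (simp add: sum.neutral)
    qed
  next
    fix c :: "nat \<Rightarrow> complex" and a
    assume c: "\<And>i. i \<in> I \<union> J \<Longrightarrow> (\<Sum>a<k+m. c a * z a i) = 0" and a: "a < k + m"
    have "(\<Sum>a<k. c a * x a i) = 0" if "i \<in> I" for i
      using c[of i] that by (simp add: splitk z_def notJ)
    then have 1: "c a = 0" if "a < k" for a using xli that by blast
    have "(\<Sum>a<m. c (k + a) * y a i) = 0" if "i \<in> J" for i
      using c[of i] that by (simp add: splitk z_def notI)
    then have 2: "c (k + a) = 0" if "a < m" for a
      using yli[rule_format, of "\<lambda>a. c (k + a)"] that by blast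
    show "c a = 0"
      using 1[of a] 2[of "a - k"] a by (cases "a < k") auto
  qed
qed

lemma isotropic_zeros:
  assumes "finite I" and "\<And>i. i \<in> I \<Longrightarrow> \<mu> i = 0"
  shows "isotropic I \<mu> (card I)"
  using assms
proof (induction I rule: finite_induct)
  case empty
  then show ?case by (simp add: isotropic_0)
next
  case (insert i I)
  have "isotropic {i} \<mu> 1"
    by (rule isotropicI[where x = "\<lambda>_ _. 1"]) (use insert.prems in auto)
  from isotropic_Un[OF this insert.IH] insert.hyps insert.prems show ?case by simp
qed

lemma isotropic_antipodal_pair:
  assumes "i \<noteq> j" and "\<mu> i = complex_of_real r * z" and "\<mu> j = - complex_of_real s * z"
    and "r > 0" and "s > 0"
  shows "isotropic {i, j} \<mu> 1"
proof (rule isotropicI[where x = "\<lambda>_ l. if l = i then complex_of_real (1 / sqrt r) else complex_of_real (1 / sqrt s)"])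
  have rs: "complex_of_real (sqrt r) * complex_of_real (sqrt r) = complex_of_real r"
     "complex_of_real (sqrt s) * complex_of_real (sqrt s) = complex_of_real s"
    using assms(4,5) by (simp_all flip: of_real_mult)
  show "(\<Sum>l\<in>{i,j}. \<mu> l * cnj (if l = i then complex_of_real (1 / sqrt r) else complex_of_real (1 / sqrt s)) *
        (if l = i then complex_of_real (1 / sqrt r) else complex_of_real (1 / sqrt s))) = 0" for a b :: nat
    using assms rs by simp
next
  fix c :: "nat \<Rightarrow> complex" and a :: nat
  assume "\<And>l. l \<in> {i,j} \<Longrightarrow> (\<Sum>a<1. c a * (if l = i then complex_of_real (1 / sqrt r) else complex_of_real (1 / sqrt s))) = 0"
    and "a < 1"
  from this(1)[of i] this(2) assms show "c a = 0" by simp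
qed

lemma sum_lagrange_zero:
  fixes T :: "real set"
  assumes fin: "finite T" and m: "m + 2 \<le> card T"
  shows "(\<Sum>t\<in>T. t ^ m / (\<Prod>u\<in>T - {t}. t - u)) = 0"
proof -
  define N where "N = card T"
  define L where "L = (\<lambda>t. \<Prod>u\<in>T - {t}. [:- u, 1:])"
  define w where "w = (\<lambda>t. \<Prod>u\<in>T - {t}. t - u)"
  define q where "q = (\<Sum>t\<in>T. smult (t ^ m / w t) (L t))"
  have w0: "w t \<noteq> 0" if "t \<in> T" for t
    using fin by (auto simp: w_def)
  have degL: "degree (L t) = N - 1" if "t \<in> T" for t
    unfolding L_def N_def using that fin
    by (subst degree_prod_eq_sum_degree) (auto simp: card_Diff_singleton)
  have leadL: "coeff (L t) (N - 1) = 1" if "t \<in> T" for t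
    using lead_coeff_prod[of "\<lambda>u. [:- u, 1:]" "T - {t}"] degL[OF that] by (simp add: L_def)
  have polyL: "poly (L t) s = (if s = t then w t else 0)" if "s \<in> T" "t \<in> T" for s t
    using that fin by (auto simp: L_def w_def poly_prod)
  have "q = monom 1 m"
  proof (rule poly_eqI_degree[of T])
    fix s assume s: "s \<in> T"
    have "poly q s = (\<Sum>t\<in>T. t ^ m / w t * (if s = t then w t else 0))"
      unfolding q_def poly_sum using s by (intro sum.cong) (auto simp: polyL)
    also have "\<dots> = s ^ m"
      using s fin w0 by (simp add: if_distrib sum.delta cong: if_cong)
    finally show "poly q s = poly (monom 1 m) s" by (simp add: poly_monom)
  next
    have "degree q \<le> N - 1"
      unfolding q_def by (rule degree_sum_le[OF fin]) (use degL in \<open>simp add: degree_smult_le\<close>)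
    then show "card T > degree q" using m N_def by simp
    show "card T > degree (monom 1 m :: real poly)"
      using m by (simp add: degree_monom_eq)
  qed
  then have "coeff q (N - 1) = 0"
    using m N_def by simp
  moreover have "coeff q (N - 1) = (\<Sum>t\<in>T. t ^ m / w t)"
    unfolding q_def coeff_sum coeff_smult by (intro sum.cong refl) (simp only: leadL mult_1_right)
  ultimately show ?thesis by (simp add: w_def)
qed

lemma isotropic_chain:
  fixes t r :: "'i \<Rightarrow> real" and e :: "'i \<Rightarrow> bool"
  assumes chain: "successively (\<lambda>i j. t i < t j \<and> e i \<noteq> e j) l"
    and \<mu>: "\<And>i. i \<in> set l \<Longrightarrow> \<mu> i = complex_of_real ((if e i then 1 else -1) * r i) * Complex (t i) 1"
    and r: "\<And>i. i \<in> set l \<Longrightarrow> r i > 0"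
  shows "isotropic (set l) \<mu> ((length l - 1) div 2)"
proof -
  define n where "n = length l"
  define T where "T = t ` set l"
  define w where "w = (\<lambda>i. \<Prod>u\<in>T - {t i}. t i - u)"
  have "successively (\<lambda>i j. t i < t j) l"
    using chain by (rule successively_mono) simp
  then have sw: "sorted_wrt (\<lambda>i j. t i < t j) l"
    by (subst (asm) successively_conv_sorted_wrt) (auto simp: transp_def)
  then have less: "t (l ! i) < t (l ! j)" if "i < j" "j < n" for i j
    using that by (simp add: sorted_wrt_iff_nth_less n_def)
  then have neq: "t (l ! i) \<noteq> t (l ! j)" if "i < n" "j < n" "i \<noteq> j" for i j
    using that by (metis less_irrefl nat_neq_iff)
  have injn: "inj_on (\<lambda>j. t (l ! j)) {..<n}"
    using neq by (auto intro: inj_onI)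
  have T: "T = (\<lambda>j. t (l ! j)) ` {..<n}"
    unfolding T_def n_def by (force simp: in_set_conv_nth)
  have inj: "inj_on t (set l)"
    using neq unfolding inj_on_def n_def by (metis in_set_conv_nth)
  have cardT: "card T = n" and finT: "finite T"
    using card_image[OF injn] by (auto simp: T)
  have alt: "e (l ! j) \<longleftrightarrow> (e (l ! 0) \<longleftrightarrow> even j)" if "j < n" for j
    using that
  proof (induction j)
    case (Suc j)
    then have "e (l ! j) \<noteq> e (l ! Suc j)"
      using successively_conv_nth[THEN iffD1, OF chain] by (auto simp: n_def)
    with Suc show ?case by auto
  qed simp
  define \<delta> :: real where "\<delta> = (if e (l ! 0) then 1 else -1) * (-1) ^ (n - 1)"
  have w: "w i \<noteq> 0 \<and> (if e i then 1 else -1) / \<bar>w i\<bar> = \<delta> / w i" if "i \<in> set l" for i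
  proof -
    obtain j where j: "j < n" "i = l ! j"
      using \<open>i \<in> set l\<close> by (auto simp: in_set_conv_nth n_def)
    have "w i = (\<Prod>k\<in>{..<n} - {j}. t (l ! j) - t (l ! k))"
    proof -
      have "T - {t i} = (\<lambda>j. t (l ! j)) ` ({..<n} - {j})"
        using j injn by (auto simp: T inj_on_def)
      then show ?thesis
        unfolding w_def using j inj_on_subset[OF injn, of "{..<n} - {j}"]
        by (simp add: prod.reindex)
    qed
    also have "{..<n} - {j} = {..<j} \<union> {j<..<n}" using j by auto
    also have "(\<Prod>k\<in>{..<j} \<union> {j<..<n}. t (l ! j) - t (l ! k)) =
        (\<Prod>k<j. t (l ! j) - t (l ! k)) * (\<Prod>k\<in>{j<..<n}. t (l ! j) - t (l ! k))"
      by (rule prod.union_disjoint) auto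
    also have "(\<Prod>k\<in>{j<..<n}. t (l ! j) - t (l ! k)) = (\<Prod>k\<in>{j<..<n}. (-1) * (t (l ! k) - t (l ! j)))"
      by simp
    also have "\<dots> = (-1) ^ (n - 1 - j) * (\<Prod>k\<in>{j<..<n}. t (l ! k) - t (l ! j))"
      by (subst prod.distrib) simp
    finally have wi: "w i = (-1) ^ (n - 1 - j) *
        ((\<Prod>k<j. t (l ! j) - t (l ! k)) * (\<Prod>k\<in>{j<..<n}. t (l ! k) - t (l ! j)))"
      (is "_ = _ * ?p") by (simp only: mult_ac)
    have p: "?p > 0"
      by (intro mult_pos_pos prod_pos) (use j less in auto)
    with wi obtain q where q: "w i = (-1) ^ (n - 1 - j) * q" "q > 0" by blast
    then have "\<bar>w i\<bar> = (-1) ^ (n - 1 - j) * w i"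
      by (simp add: abs_mult minus_one_power_iff)
    moreover have "\<delta> = (if e i then 1 else -1) * (-1) ^ (n - 1 - j)"
    proof -
      have "(-1::real) ^ (n - 1) = (-1) ^ j * (-1) ^ (n - 1 - j)"
        using j by (simp flip: power_add)
      then show ?thesis
        using alt[OF j(1)] j(2) by (simp add: \<delta>_def minus_one_power_iff)
    qed
    moreover have "w i \<noteq> 0" using q by auto
    ultimately show ?thesis by (auto simp: field_simps simp flip: power_add mult.assoc)
  qed
  define \<kappa> where "\<kappa> = (n - 1) div 2"
  define x where "x = (\<lambda>a i. complex_of_real (t i ^ a / sqrt (r i * \<bar>w i\<bar>)))"
  have L0: "(\<Sum>i\<in>set l. t i ^ m / w i) = 0" if "m + 2 \<le> n" for m
  proof -
    have "(\<Sum>i\<in>set l. t i ^ m / w i) = (\<Sum>s\<in>T. s ^ m / (\<Prod>u\<in>T - {s}. s - u))"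
      unfolding T_def by (subst sum.reindex[OF inj]) (simp add: w_def T_def)
    then show ?thesis using sum_lagrange_zero[OF finT] that cardT by simp
  qed
  have "isotropic (set l) \<mu> \<kappa>"
  proof (rule isotropicI[where x = x])
    fix a b assume ab: "a < \<kappa>" "b < \<kappa>"
    have n2: "a + b + 1 + 2 \<le> n" using ab by (auto simp: \<kappa>_def)
    have "\<mu> i * cnj (x a i) * x b i =
        complex_of_real \<delta> * (complex_of_real (t i ^ (a + b + 1) / w i) + \<i> * complex_of_real (t i ^ (a + b) / w i))"
      if i: "i \<in> set l" for i
    proof -
      have "cnj (x a i) * x b i = complex_of_real (t i ^ a * t i ^ b / (sqrt (r i * \<bar>w i\<bar>) * sqrt (r i * \<bar>w i\<bar>)))"
        by (simp only: x_def complex_cnj_complex_of_real of_real_mult[symmetric] times_divide_times_eq)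
      also have "sqrt (r i * \<bar>w i\<bar>) * sqrt (r i * \<bar>w i\<bar>) = r i * \<bar>w i\<bar>"
        using r[OF i] by simp
      finally have "\<mu> i * cnj (x a i) * x b i =
          complex_of_real ((if e i then 1 else -1) * r i * (t i ^ (a + b) / (r i * \<bar>w i\<bar>))) * Complex (t i) 1"
        unfolding mult.assoc[of "\<mu> i"] \<mu>[OF i] by (simp add: power_add)
      also have "(if e i then 1 else -1) * r i * (t i ^ (a + b) / (r i * \<bar>w i\<bar>)) =
          t i ^ (a + b) * ((if e i then 1 else -1) / \<bar>w i\<bar>)"
        using r[OF i] by simp
      also have "\<dots> = \<delta> * (t i ^ (a + b) / w i)"
        using w[OF i] by simp
      finally show ?thesis
        by (simp add: complex_eq_iff power_add)
    qed
    then have "(\<Sum>i\<in>set l. \<mu> i * cnj (x a i) * x b i) = (\<Sum>i\<in>set l. complex_of_real \<delta> *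
        (complex_of_real (t i ^ (a + b + 1) / w i) + \<i> * complex_of_real (t i ^ (a + b) / w i)))"
      by (rule sum.cong[OF refl])
    also have "\<dots> = complex_of_real \<delta> * (complex_of_real (\<Sum>i\<in>set l. t i ^ (a + b + 1) / w i) +
          \<i> * complex_of_real (\<Sum>i\<in>set l. t i ^ (a + b) / w i))"
      by (simp only: of_real_sum sum_distrib_left sum.distrib distrib_left)
    also have "\<dots> = 0"
      using L0[of "a + b + 1"] L0[of "a + b"] n2 by simp
    finally show "(\<Sum>i\<in>set l. \<mu> i * cnj (x a i) * x b i) = 0" .
  next
    fix c :: "nat \<Rightarrow> complex" and a
    assume c: "\<And>i. i \<in> set l \<Longrightarrow> (\<Sum>a<\<kappa>. c a * x a i) = 0" and a: "a < \<kappa>"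
    define p where "p = (\<Sum>a<\<kappa>. monom (c a) a)"
    have "degree p \<le> \<kappa> - 1"
      unfolding p_def by (rule degree_sum_le) (auto intro!: order_trans[OF degree_monom_le])
    then have degp: "degree p < n" using a by (auto simp: \<kappa>_def)
    have "p = 0"
    proof (rule poly_eqI_degree[of "complex_of_real ` T"])
      fix z assume "z \<in> complex_of_real ` T"
      then obtain i where i: "i \<in> set l" "z = complex_of_real (t i)" by (auto simp: T_def)
      have "poly p z = complex_of_real (sqrt (r i * \<bar>w i\<bar>)) * (\<Sum>a<\<kappa>. c a * x a i)"
        using w[OF i(1)] r[OF i(1)]
        by (auto simp: p_def poly_sum poly_monom i x_def sum_distrib_left intro!: sum.cong)
      with c i show "poly p z = poly 0 z" by simp
    qed (use degp cardT in \<open>simp_all add: card_image inj_on_def\<close>)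
    moreover have "coeff p a = c a"
      using a by (simp add: p_def coeff_sum)
    ultimately show "c a = 0" by simp
  qed
  then show ?thesis by (simp add: \<kappa>_def n_def)
qed

section \<open>Alternating chains and half-plane counts\<close>

definition excess :: "('i \<Rightarrow> bool) \<Rightarrow> bool \<Rightarrow> 'i list \<Rightarrow> int" where
  "excess e s xs = (\<Sum>i\<leftarrow>xs. if e i = s then 1 else -1)"

lemma excess_simps [simp]:
  "excess e s [] = 0"
  "excess e s (i # xs) = (if e i = s then 1 else -1) + excess e s xs"
  "excess e s (xs @ ys) = excess e s xs + excess e s ys"
  by (simp_all add: excess_def)

lemma excess_eq_count:
  "excess e s xs = int (length (filter (\<lambda>i. e i = s) xs)) - int (length (filter (\<lambda>i. e i \<noteq> s) xs))"
  by (induction xs) auto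

lemma length_eq_count:
  "length xs = length (filter (\<lambda>i. e i = s) xs) + length (filter (\<lambda>i. e i \<noteq> s) xs)"
  by (induction xs) auto

lemma excess_alternating:
  fixes e :: "'i \<Rightarrow> bool"
  assumes "successively (\<lambda>i j. e i \<noteq> e j) l" and "l \<noteq> []"
  shows "excess e s l = (if e (hd l) = s then 1 else 0) - (if e (last l) = s then 0 else 1)"
  using assms by (induction l rule: induct_list012) auto

lemma count_alternating:
  fixes e :: "'i \<Rightarrow> bool"
  assumes "successively (\<lambda>i j. e i \<noteq> e j) l" and "l \<noteq> []"
  shows "length (filter (\<lambda>i. e i = s) l) =
    (length l - 1) div 2 + (if e (hd l) = s \<or> e (last l) = s then 1 else 0)"
proof -
  define p q where "p = length (filter (\<lambda>i. e i = s) l)" and "q = length (filter (\<lambda>i. e i \<noteq> s) l)"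
  have "length l = p + q"
    using length_eq_count[of l e s] by (simp only: p_def q_def)
  moreover from this have "p + q \<noteq> 0"
    using assms(2) by auto
  moreover have "int p - int q = (if e (hd l) = s then 1 else 0) - (if e (last l) = s then 0 else 1)"
    using excess_alternating[OF assms, of s] excess_eq_count[of e s l] by (simp add: p_def q_def)
  ultimately have "p = (length l - 1) div 2 + (if e (hd l) = s \<or> e (last l) = s then 1 else 0)"
    by (cases "e (hd l) = s"; cases "e (last l) = s"; simp only: if_True if_False simp_thms; presburger)
  then show ?thesis by (simp only: p_def)
qed

lemma excess_mset:
  assumes "mset xs = (\<Sum>l\<in>#M. mset l)"
  shows "excess e s xs = (\<Sum>l\<in>#M. excess e s l)"
proof -
  have 1: "excess e s xs = (\<Sum>i\<in>#mset xs. if e i = s then 1 else -1)" for xs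
    by (induction xs) auto
  have "(\<Sum>i\<in>#(\<Sum>l\<in>#M. mset l). if e i = s then 1 else -1) = (\<Sum>l\<in>#M. excess e s l)"
    by (induction M) (auto simp: 1)
  with 1 assms show ?thesis by simp
qed

abbreviation heads :: "('i \<Rightarrow> bool) \<Rightarrow> bool \<Rightarrow> 'i list multiset \<Rightarrow> nat" where
  "heads e s M \<equiv> size {#l \<in># M. e (hd l) = s#}"

text \<open>
  A new entry of sign \<open>s\<close> extends a chain ending in the opposite sign, preferably one that starts with \<open>s\<close>.
  This preference prevents chains from \<open>+\<close> to \<open>-\<close> and chains from \<open>-\<close> to \<open>+\<close> from coexisting, and a new
  chain is opened only when the walk of partial excesses reaches a new extremum.
\<close>

lemma alternating_decomposition:
  fixes t :: "'i \<Rightarrow> real" and e :: "'i \<Rightarrow> bool"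
  assumes "sorted_wrt (\<lambda>i j. t i \<le> t j) xs"
    and "\<forall>i\<in>set xs. \<forall>j\<in>set xs. t i = t j \<longrightarrow> e i = e j"
  shows "\<exists>M. (\<forall>l\<in>#M. l \<noteq> [] \<and> successively (\<lambda>i j. t i < t j \<and> e i \<noteq> e j) l) \<and>
    mset xs = (\<Sum>l\<in>#M. mset l) \<and>
    (\<exists>s. \<forall>l\<in>#M. \<not> (e (hd l) = s \<and> e (last l) \<noteq> s)) \<and>
    (\<forall>s. \<exists>ys zs. xs = ys @ zs \<and> int (heads e s M) = excess e s ys)"
  using assms
proof (induction xs rule: rev_induct)
  case Nil
  show ?case by (intro exI[of _ "{#}"]) auto
next
  case (snoc x xs)
  let ?R = "\<lambda>i j. t i < t j \<and> e i \<noteq> e j"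
  have sorted: "sorted_wrt (\<lambda>i j. t i \<le> t j) xs" and le: "\<forall>i\<in>set xs. t i \<le> t x"
    using snoc.prems(1) by (simp_all add: sorted_wrt_append)
  have ties: "\<forall>i\<in>set xs. \<forall>j\<in>set xs. t i = t j \<longrightarrow> e i = e j"
    and ties_x: "\<And>i. i \<in> set xs \<Longrightarrow> t i = t x \<Longrightarrow> e i = e x"
    using snoc.prems(2) by (metis UnI1 set_append, metis UnCI list.set_intros(1) set_append)
  from snoc.IH[OF sorted ties] obtain M where
    M0: "(\<forall>l\<in>#M. l \<noteq> [] \<and> successively ?R l) \<and> mset xs = (\<Sum>l\<in>#M. mset l) \<and>
      (\<exists>s. \<forall>l\<in>#M. \<not> (e (hd l) = s \<and> e (last l) \<noteq> s)) \<and>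
      (\<forall>s. \<exists>ys zs. xs = ys @ zs \<and> int (heads e s M) = excess e s ys)" ..
  note M = M0[THEN conjunct1, rule_format]
    and mset = M0[THEN conjunct2, THEN conjunct1]
    and heads = M0[THEN conjunct2, THEN conjunct2, THEN conjunct2, rule_format]
  obtain s0 where s0: "\<And>l. l \<in># M \<Longrightarrow> \<not> (e (hd l) = s0 \<and> e (last l) \<noteq> s0)"
    using M0[THEN conjunct2, THEN conjunct2, THEN conjunct1] by blast
  have mem: "set l \<subseteq> set xs" if "l \<in># M" for l
  proof -
    have "mset l \<subseteq># mset xs"
      unfolding mset using that by (metis image_mset_add_mset insert_DiffM mset_subset_eq_add_left sum_mset.insert)
    then show ?thesis by (metis set_mset_mono set_mset_mset)
  qed
  have R: "?R (last l) x" if l: "l \<in># M" and "e (last l) \<noteq> e x" for l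
  proof -
    have "last l \<in> set xs" using M[OF l] mem[OF l] by auto
    with le ties_x[of "last l"] that show ?thesis by force
  qed
  have extend: ?case
    if l: "l \<in># M" and "e (last l) \<noteq> e x"
      and s: "\<And>l'. l' \<in># add_mset (l @ [x]) (M - {#l#}) \<Longrightarrow> \<not> (e (hd l') = s \<and> e (last l') \<noteq> s)" for l s
  proof (intro exI conjI)
    let ?M = "add_mset (l @ [x]) (M - {#l#})"
    have Ml: "M = add_mset l (M - {#l#})" using l by simp
    have l0: "l \<noteq> []" using M[OF l] by simp
    show "\<forall>l\<in>#?M. l \<noteq> [] \<and> successively ?R l"
      using M l R[OF l that(2)] l0 by (auto simp: successively_append_iff dest: in_diffD)
    show "mset (xs @ [x]) = (\<Sum>l\<in>#?M. mset l)"
      by (subst Ml, simp add: mset del: insert_DiffM) (use arg_cong[OF Ml, of "\<lambda>M. \<Sum>l\<in>#M. mset l"] in simp)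
    show "\<forall>l\<in>#?M. \<not> (e (hd l) = s \<and> e (last l) \<noteq> s)" using s by blast
    show "\<forall>s. \<exists>ys zs. xs @ [x] = ys @ zs \<and> int (heads e s ?M) = excess e s ys"
    proof
      fix s
      have "heads e s ?M = heads e s M"
        by (subst (2) Ml) (simp add: l0)
      moreover obtain ys zs where "xs = ys @ zs" "int (heads e s M) = excess e s ys"
        using heads by blast
      ultimately show "\<exists>ys zs. xs @ [x] = ys @ zs \<and> int (heads e s ?M) = excess e s ys"
        by (intro exI[of _ ys] exI[of _ "zs @ [x]"]) simp
    qed
  qed
  show ?case
  proof (cases "\<exists>l\<in>#M. e (last l) \<noteq> e x \<and> e (hd l) = e x")
    case True
    then obtain l where l: "l \<in># M" "e (last l) \<noteq> e x" "e (hd l) = e x" by blast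
    then have "s0 = (\<not> e x)" using s0[OF l(1)] by auto
    show ?thesis
    proof (rule extend[OF l(1,2)])
      fix l' assume "l' \<in># add_mset (l @ [x]) (M - {#l#})"
      then show "\<not> (e (hd l') = s0 \<and> e (last l') \<noteq> s0)"
        using s0 l M[OF l(1)] \<open>s0 = (\<not> e x)\<close> by (auto dest: in_diffD)
    qed
  next
    case noA: False
    show ?thesis
    proof (cases "\<exists>l\<in>#M. e (last l) \<noteq> e x")
      case True
      then obtain l where l: "l \<in># M" "e (last l) \<noteq> e x" by blast
      show ?thesis
      proof (rule extend[OF l])
        fix l' assume "l' \<in># add_mset (l @ [x]) (M - {#l#})"
        then show "\<not> (e (hd l') = e x \<and> e (last l') \<noteq> e x)"
          using noA by (auto dest: in_diffD)
      qed
    next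
      case False
      show ?thesis
      proof (intro exI conjI)
        let ?M = "add_mset [x] M"
        show "\<forall>l\<in>#?M. l \<noteq> [] \<and> successively ?R l" using M by auto
        show "mset (xs @ [x]) = (\<Sum>l\<in>#?M. mset l)" using mset by simp
        show "\<forall>l\<in>#?M. \<not> (e (hd l) = e x \<and> e (last l) \<noteq> e x)" using False by auto
        show "\<forall>s. \<exists>ys zs. xs @ [x] = ys @ zs \<and> int (heads e s ?M) = excess e s ys"
        proof
          fix s
          show "\<exists>ys zs. xs @ [x] = ys @ zs \<and> int (heads e s ?M) = excess e s ys"
          proof (cases "s = e x")
            case True
            have "excess e s l = (if e (hd l) = s then 1 else 0)" if l: "l \<in># M" for l
            proof -
              have "successively (\<lambda>i j. e i \<noteq> e j) l"
                using M[OF l] by (auto elim: successively_mono)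
              from excess_alternating[OF this] M[OF l] False l True show ?thesis by simp
            qed
            then have "excess e s xs = (\<Sum>l\<in>#M. if e (hd l) = s then 1 else 0)"
              unfolding excess_mset[OF mset] by (intro arg_cong[where f = sum_mset] image_mset_cong) auto
            also have "\<dots> = int (heads e s M)"
              by (induction M) auto
            finally show ?thesis
              using True by (intro exI[of _ "xs @ [x]"] exI[of _ "[]"]) simp
          next
            case False
            moreover obtain ys zs where "xs = ys @ zs" "int (heads e s M) = excess e s ys"
              using heads by blast
            ultimately show ?thesis
              by (intro exI[of _ ys] exI[of _ "zs @ [x]"]) auto
          qed
        qed
      qed
    qed
  qed
qed

lemma isotropic_Union_mset:
  assumes "distinct xs" and "mset xs = (\<Sum>l\<in>#M. mset l)"
    and "\<And>l. l \<in># M \<Longrightarrow> isotropic (set l) \<mu> (f l)"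
  shows "isotropic (set xs) \<mu> (\<Sum>l\<in>#M. f l)"
  using assms
proof (induction M arbitrary: xs)
  case empty
  then show ?case by (simp add: isotropic_0)
next
  case (add l M)
  obtain ys where ys: "mset ys = (\<Sum>l\<in>#M. mset l)" using ex_mset by blast
  then have "mset xs = mset (l @ ys)" using add.prems(2) by simp
  then have "distinct (l @ ys)" "set xs = set (l @ ys)"
    using add.prems(1) mset_eq_imp_distinct_iff[of xs "l @ ys"] mset_eq_setD[of xs "l @ ys"] by simp_all
  moreover have "isotropic (set ys) \<mu> (\<Sum>l\<in>#M. f l)"
    using calculation(1) ys add.prems(3) by (intro add.IH) auto
  moreover have "isotropic (set l) \<mu> (f l)" using add.prems(3) by simp
  ultimately show ?case
    using isotropic_Un[of "set l" \<mu> "f l" "set ys" "\<Sum>l\<in>#M. f l"] by simp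
qed

lemma infinite_Ioo_avoid:
  fixes lo hi :: real
  assumes "lo < hi" and "finite F"
  obtains c where "c \<notin> F" "lo < c" "c < hi"
proof -
  have "infinite ({lo<..<hi} - F)"
    using assms by (simp add: infinite_Ioo)
  then obtain c where "c \<in> {lo<..<hi} - F" by (metis finite.emptyI ex_in_conv)
  with that show thesis by auto
qed

lemma slightly_above:
  fixes \<tau> :: real
  assumes "finite F" and "finite T"
  obtains c where "c \<notin> F" "\<tau> < c" "\<And>t. t \<in> T \<Longrightarrow> t < c \<Longrightarrow> t \<le> \<tau>"
proof -
  let ?S = "insert (\<tau> + 1) {t \<in> T. \<tau> < t}"
  have fin: "finite ?S" using assms by simp
  have "\<tau> < Min ?S" using fin by (subst Min_gr_iff) auto
  then obtain c where c: "c \<notin> F" "\<tau> < c" "c < Min ?S"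
    using infinite_Ioo_avoid assms(1) by blast
  show thesis
  proof (rule that[OF c(1,2)])
    fix t assume "t \<in> T" "t < c"
    show "t \<le> \<tau>"
    proof (rule ccontr)
      assume "\<not> t \<le> \<tau>"
      then have "Min ?S \<le> t" using fin \<open>t \<in> T\<close> by (intro Min_le) auto
      with c \<open>t < c\<close> show False by simp
    qed
  qed
qed

lemma slightly_below:
  fixes \<tau> :: real
  assumes "finite F" and "finite T"
  obtains c where "c \<notin> F" "c < \<tau>" "\<And>t. t \<in> T \<Longrightarrow> c < t \<Longrightarrow> \<tau> \<le> t"
proof -
  obtain c where c: "c \<notin> uminus ` F" "- \<tau> < c" "\<And>t. t \<in> uminus ` T \<Longrightarrow> t < c \<Longrightarrow> t \<le> - \<tau>"
    using slightly_above[of "uminus ` F" "uminus ` T" "- \<tau>"] assms by blast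
  show thesis
  proof (rule that[of "- c"])
    show "- c \<notin> F" using c(1) by (metis imageI minus_minus)
    show "- c < \<tau>" using c(2) by simp
    fix t assume "t \<in> T" "- c < t"
    then show "\<tau> \<le> t" using c(3)[of "- t"] by auto
  qed
qed

lemma count_cut:
  fixes t :: "'i \<Rightarrow> real" and e :: "'i \<Rightarrow> bool"
  assumes sorted: "sorted_wrt (\<lambda>i j. t i \<le> t j) (ys @ zs)"
    and dist: "distinct (ys @ zs)"
    and ties: "\<And>i j. i \<in> set (ys @ zs) \<Longrightarrow> j \<in> set (ys @ zs) \<Longrightarrow> t i = t j \<Longrightarrow> e i = e j"
    and F: "finite F"
    and half: "\<And>c. c \<notin> F \<Longrightarrow> k \<le> card {i \<in> set (ys @ zs). if e i = u then c < t i else t i < c}"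
  shows "k \<le> length (filter (\<lambda>i. e i = u) zs) + length (filter (\<lambda>i. e i \<noteq> u) ys)"
proof -
  have le: "t i \<le> t j" if "i \<in> set ys" "j \<in> set zs" for i j
    using sorted that by (auto simp: sorted_wrt_append)
  have *: ?thesis
    if "c \<notin> F" and 1: "\<And>i. i \<in> set ys \<Longrightarrow> e i = u \<Longrightarrow> \<not> c < t i"
      and 2: "\<And>i. i \<in> set zs \<Longrightarrow> e i \<noteq> u \<Longrightarrow> \<not> t i < c" for c
  proof -
    have "k \<le> card {i \<in> set (ys @ zs). if e i = u then c < t i else t i < c}"
      using half \<open>c \<notin> F\<close> .
    also have "\<dots> \<le> card (set (filter (\<lambda>i. e i = u) zs @ filter (\<lambda>i. e i \<noteq> u) ys))"
      using 1 2 by (intro card_mono) (auto split: if_splits)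
    also have "\<dots> \<le> length (filter (\<lambda>i. e i = u) zs @ filter (\<lambda>i. e i \<noteq> u) ys)"
      by (rule card_length)
    finally show ?thesis by simp
  qed
  let ?T = "t ` set (ys @ zs)"
  have last: "t i \<le> t (last ys)" if "i \<in> set ys" for i
  proof -
    have "ys = butlast ys @ [last ys]" using that by (cases ys) auto
    with sorted that show ?thesis
      by (metis UnE append_Nil2 empty_iff insert_iff list.set(1,2) order_refl set_append sorted_wrt_append)
  qed
  have hd: "t (hd zs) \<le> t i" if "i \<in> set zs" for i
    using sorted that by (cases zs) (auto simp: sorted_wrt_append)
  consider "ys \<noteq> []" "\<forall>i\<in>set zs. e i \<noteq> u \<longrightarrow> t i \<noteq> t (last ys)"
    | "zs \<noteq> []" "ys = [] \<or> (\<exists>i\<in>set zs. e i \<noteq> u \<and> t i = t (last ys))"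
    | "ys = []" "zs = []"
    by fastforce
  then show ?thesis
  proof cases
    case 1
    obtain c where c: "c \<notin> F" "t (last ys) < c" "\<And>s. s \<in> ?T \<Longrightarrow> s < c \<Longrightarrow> s \<le> t (last ys)"
      using slightly_above[of F ?T "t (last ys)"] F by auto
    show ?thesis
    proof (rule *[OF c(1)])
      fix i assume "i \<in> set ys" then show "\<not> c < t i" using last[of i] c(2) by simp
    next
      fix i assume i: "i \<in> set zs" "e i \<noteq> u"
      show "\<not> t i < c"
        using c(3)[of "t i"] i 1 le[of "last ys" i] by force
    qed
  next
    case 2
    obtain c where c: "c \<notin> F" "c < t (hd zs)" "\<And>s. s \<in> ?T \<Longrightarrow> c < s \<Longrightarrow> t (hd zs) \<le> s"
      using slightly_below[of F ?T "t (hd zs)"] F by auto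
    show ?thesis
    proof (rule *[OF c(1)])
      fix i assume i: "i \<in> set ys" "e i = u"
      then obtain j where j: "j \<in> set zs" "e j \<noteq> u" "t j = t (last ys)" using 2(2) by auto
      show "\<not> c < t i"
      proof
        assume "c < t i"
        then have "t (hd zs) \<le> t i" using c(3) i by auto
        moreover have "t (last ys) \<le> t (hd zs)" using le i(1) 2(1) by (metis empty_iff last_in_set list.set(1) list.set_sel(1))
        ultimately have "t i = t j" using last[OF i(1)] j(3) by simp
        then show False using ties[of i j] i j by auto
      qed
    next
      fix i assume "i \<in> set zs" then show "\<not> t i < c" using hd[of i] c(2) by simp
    qed
  next
    case 3
    obtain c where "c \<notin> F" using infinite_Ioo_avoid[of 0 1 F] F by auto
    with 3 show ?thesis using half by fastforce
  qed
qed

lemma isotropic_no_antipodal: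
  fixes t r :: "'i \<Rightarrow> real" and e :: "'i \<Rightarrow> bool"
  assumes fin: "finite I" and F: "finite F"
    and ties: "\<And>i j. i \<in> I \<Longrightarrow> j \<in> I \<Longrightarrow> t i = t j \<Longrightarrow> e i = e j"
    and half: "\<And>c u. c \<notin> F \<Longrightarrow> k \<le> card {i \<in> I. if e i = u then c < t i else t i < c}"
    and \<mu>: "\<And>i. i \<in> I \<Longrightarrow> \<mu> i = complex_of_real ((if e i then 1 else -1) * r i) * Complex (t i) 1"
    and r: "\<And>i. i \<in> I \<Longrightarrow> r i > 0"
  shows "isotropic I \<mu> k"
proof -
  obtain xs0 where xs0: "set xs0 = I" "distinct xs0"
    using finite_distinct_list[OF fin] by blast
  define xs where "xs = sort_key t xs0"
  have xs: "set xs = I" "distinct xs" "sorted_wrt (\<lambda>i j. t i \<le> t j) xs"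
    using xs0 sorted_sort_key[of t xs0] by (simp_all add: xs_def sorted_map)
  have "\<forall>i\<in>set xs. \<forall>j\<in>set xs. t i = t j \<longrightarrow> e i = e j"
    using ties unfolding xs(1) by blast
  from alternating_decomposition[OF xs(3) this] obtain M where
    M0: "(\<forall>l\<in>#M. l \<noteq> [] \<and> successively (\<lambda>i j. t i < t j \<and> e i \<noteq> e j) l) \<and>
      mset xs = (\<Sum>l\<in>#M. mset l) \<and>
      (\<exists>s. \<forall>l\<in>#M. \<not> (e (hd l) = s \<and> e (last l) \<noteq> s)) \<and>
      (\<forall>s. \<exists>ys zs. xs = ys @ zs \<and> int (heads e s M) = excess e s ys)" ..
  note M = M0[THEN conjunct1, rule_format]
    and mset = M0[THEN conjunct2, THEN conjunct1]
    and heads = M0[THEN conjunct2, THEN conjunct2, THEN conjunct2, rule_format]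
  obtain s where s: "\<And>l. l \<in># M \<Longrightarrow> \<not> (e (hd l) = s \<and> e (last l) \<noteq> s)"
    using M0[THEN conjunct2, THEN conjunct2, THEN conjunct1] by blast
  define u where "u = (\<not> s)"
  define K where "K = (\<Sum>l\<in>#M. (length l - 1) div 2)"
  have "isotropic (set xs) \<mu> K"
    unfolding K_def
  proof (rule isotropic_Union_mset[OF xs(2) mset])
    fix l assume l: "l \<in># M"
    have "mset l \<subseteq># mset xs"
      unfolding mset using l by (metis image_mset_add_mset insert_DiffM mset_subset_eq_add_left sum_mset.insert)
    then have "set l \<subseteq> I" using xs(1) by (metis set_mset_mono set_mset_mset)
    then show "isotropic (set l) \<mu> ((length l - 1) div 2)"
      using M[OF l] \<mu> r by (intro isotropic_chain[where t = t and e = e and r = r]) auto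
  qed
  moreover have "k \<le> K"
  proof -
    obtain ys zs where yz: "xs = ys @ zs" "int (heads e u M) = excess e u ys"
      using heads by blast
    have count: "length (filter (\<lambda>i. e i = u) l) = (length l - 1) div 2 + (if e (hd l) = u then 1 else 0)"
      if l: "l \<in># M" for l
    proof -
      have "successively (\<lambda>i j. e i \<noteq> e j) l"
        using M[OF l] by (auto elim: successively_mono)
      from count_alternating[OF this, of u] M[OF l] s[OF l] show ?thesis
        by (auto simp: u_def)
    qed
    have "length (filter (\<lambda>i. e i = u) xs) = size {#i \<in># (\<Sum>l\<in>#M. mset l). e i = u#}"
      by (simp flip: mset mset_filter)
    also have "\<dots> = (\<Sum>l\<in>#M. length (filter (\<lambda>i. e i = u) l))"
      by (induction M) (auto simp flip: size_mset mset_filter)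
    also have "\<dots> = (\<Sum>l\<in>#M. (length l - 1) div 2 + (if e (hd l) = u then 1 else 0))"
      using count by (intro arg_cong[where f = sum_mset] image_mset_cong) simp
    also have "\<dots> = K + heads e u M"
      unfolding K_def by (induction M) auto
    finally have "int K = int (length (filter (\<lambda>i. e i = u) zs) + length (filter (\<lambda>i. e i \<noteq> u) ys))"
      using yz(2) excess_eq_count[of e u ys] by (simp only: yz(1) filter_append length_append)
    moreover have "k \<le> length (filter (\<lambda>i. e i = u) zs) + length (filter (\<lambda>i. e i \<noteq> u) ys)"
      by (rule count_cut[where t = t and F = F]) (use xs yz(1) ties F half in auto)
    ultimately show ?thesis by linarith
  qed
  ultimately show ?thesis using isotropic_mono xs(1) by blast
qed

text \<open>
  The finite set \<open>F\<close> of excluded directions makes the half-plane hypothesis stable under removing an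
  antipodal pair: such a pair has exactly one member in every half-plane whose boundary avoids it.
\<close>

lemma isotropic_half_planes:
  fixes t r :: "'i \<Rightarrow> real" and e :: "'i \<Rightarrow> bool"
  assumes "finite I" and "finite F"
    and "\<And>c u. c \<notin> F \<Longrightarrow> k \<le> card {i \<in> I. if e i = u then c < t i else t i < c}"
    and "\<And>i. i \<in> I \<Longrightarrow> \<mu> i = complex_of_real ((if e i then 1 else -1) * r i) * Complex (t i) 1"
    and "\<And>i. i \<in> I \<Longrightarrow> r i > 0"
  shows "isotropic I \<mu> k"
  using assms
proof (induction "card I" arbitrary: I k F rule: less_induct)
  case less
  note fin = less.prems(1) and half = less.prems(3) and \<mu> = less.prems(4) and r = less.prems(5)
  show ?case
  proof (cases "k = 0 \<or> (\<forall>i\<in>I. \<forall>j\<in>I. t i = t j \<longrightarrow> e i = e j)")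
    case True
    show ?thesis
    proof (cases "k = 0")
      case False
      with True have "\<And>i j. i \<in> I \<Longrightarrow> j \<in> I \<Longrightarrow> t i = t j \<Longrightarrow> e i = e j" by blast
      from isotropic_no_antipodal[OF fin less.prems(2) this half \<mu> r] show ?thesis .
    qed (simp add: isotropic_0)
  next
    case False
    then have "\<exists>i\<in>I. \<exists>j\<in>I. t i = t j \<and> e i \<noteq> e j" by simp
    then obtain i j where ij: "i \<in> I" "j \<in> I" "t i = t j" "e i" "\<not> e j" by metis
    have "i \<noteq> j" using ij by auto
    define I' where "I' = I - {i, j}"
    have "isotropic I' \<mu> (k - 1)"
    proof (rule less.hyps)
      show "card I' < card I"
        unfolding I'_def using ij fin by (intro psubset_card_mono) auto
      show "finite I'" using fin by (simp add: I'_def)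
      show "finite (insert (t i) F)" using less.prems(2) by simp
      fix c u assume c: "c \<notin> insert (t i) F"
      let ?S = "\<lambda>I. {i \<in> I. if e i = u then c < t i else t i < c}"
      obtain m where "?S I \<subseteq> insert m (?S I')"
      proof (cases "u = (c < t i)")
        case True
        then have "?S I \<subseteq> insert i (?S I')" using ij c by (auto simp: I'_def split: if_splits)
        then show thesis by (rule that)
      next
        case False
        then have "?S I \<subseteq> insert j (?S I')" using ij c by (auto simp: I'_def split: if_splits)
        then show thesis by (rule that)
      qed
      then have "card (?S I) \<le> card (insert m (?S I'))"
        using fin by (intro card_mono) (auto simp: I'_def)
      also have "\<dots> \<le> Suc (card (?S I'))" by (rule card_insert_le_m1) auto
      finally show "k - 1 \<le> card (?S I')" using half[of c u] c by simp
    qed (use \<mu> r in \<open>auto simp: I'_def\<close>)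
    moreover have "isotropic {i, j} \<mu> 1"
      using \<open>i \<noteq> j\<close> \<mu>[OF ij(1)] \<mu>[OF ij(2)] ij r
      by (intro isotropic_antipodal_pair[where z = "Complex (t i) 1" and r = "r i" and s = "r j"]) auto
    ultimately have "isotropic ({i, j} \<union> I') \<mu> (1 + (k - 1))"
      using fin by (intro isotropic_Un) (auto simp: I'_def)
    moreover have "{i, j} \<union> I' = I" using ij by (auto simp: I'_def)
    ultimately show ?thesis using False by simp
  qed
qed

lemma hull_imp_isotropic:
  assumes fin: "finite I" and k: "1 \<le> k" "k \<le> card I"
    and hull: "\<And>J. J \<subseteq> I \<Longrightarrow> card J = card I - k + 1 \<Longrightarrow> 0 \<in> convex hull (\<mu> ` J)"
  shows "isotropic I \<mu> k"
proof -
  define Z where "Z = {i \<in> I. \<mu> i = 0}"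
  define N where "N = I - Z"
  have "infinite (UNIV - (\<lambda>i. - Re (\<mu> i) / Im (\<mu> i)) ` I)"
    using fin infinite_UNIV_char_0[where 'a = real] by simp
  then obtain a where "a \<in> UNIV - (\<lambda>i. - Re (\<mu> i) / Im (\<mu> i)) ` I"
    by (metis finite.emptyI ex_in_conv)
  then have a: "a \<noteq> - Re (\<mu> i) / Im (\<mu> i)" if "i \<in> I" for i
    using that by auto
  define w where "w = Complex a 1"
  define \<nu> where "\<nu> = (\<lambda>i. w * \<mu> i)"
  define e where "e = (\<lambda>i. Im (\<nu> i) > 0)"
  define r where "r = (\<lambda>i. \<bar>Im (\<nu> i)\<bar>)"
  define t where "t = (\<lambda>i. Re (\<nu> i) / Im (\<nu> i))"
  have w0: "w \<noteq> 0" by (simp add: w_def complex_eq_iff)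
  have Im0: "Im (\<nu> i) \<noteq> 0" if "i \<in> N" for i
  proof -
    from that have "i \<in> I" "\<mu> i \<noteq> 0" by (auto simp: N_def Z_def)
    show ?thesis
    proof (cases "Im (\<mu> i) = 0")
      case True
      with \<open>\<mu> i \<noteq> 0\<close> show ?thesis by (auto simp: \<nu>_def w_def complex_eq_iff)
    next
      case False
      have "a * Im (\<mu> i) + Re (\<mu> i) \<noteq> 0"
      proof
        assume "a * Im (\<mu> i) + Re (\<mu> i) = 0"
        then have "a = - Re (\<mu> i) / Im (\<mu> i)" using False by (simp add: field_simps)
        with a[OF \<open>i \<in> I\<close>] show False by simp
      qed
      then show ?thesis by (simp add: \<nu>_def w_def)
    qed
  qed
  have "isotropic N \<nu> (k - card Z)"
  proof (rule isotropic_half_planes[where t = t and e = e and r = r and F = "t ` N"])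
    show "finite N" using fin by (simp add: N_def)
    then show "finite (t ` N)" by simp
    show "\<nu> i = complex_of_real ((if e i then 1 else -1) * r i) * Complex (t i) 1" if "i \<in> N" for i
      using Im0[OF that] by (auto simp: complex_eq_iff e_def r_def t_def)
    show "r i > 0" if "i \<in> N" for i using Im0[OF that] by (simp add: r_def)
    fix c u assume c: "c \<notin> t ` N"
    define S where "S = {i \<in> N. if e i = u then c < t i else t i < c}"
    define \<sigma> :: real where "\<sigma> = (if u then 1 else -1)"
    have "k \<le> card S + card Z"
    proof (rule ccontr)
      assume *: "\<not> k \<le> card S + card Z"
      have "finite S" "finite Z" "S \<inter> Z = {}" "S \<union> Z \<subseteq> I"
        using fin by (auto simp: S_def N_def Z_def)
      then have "card (I - (S \<union> Z)) = card I - (card S + card Z)"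
        by (simp add: card_Diff_subset card_Un_disjoint)
      then have "card I - k + 1 \<le> card (I - (S \<union> Z))" using * k by simp
      then obtain J where J: "J \<subseteq> I - (S \<union> Z)" "card J = card I - k + 1"
        using obtain_subset_with_card_n by metis
      define v where "v = Complex (\<sigma> * (a - c)) (\<sigma> * (- 1 - c * a))"
      have v: "inner v z = \<sigma> * (Re (w * z) - c * Im (w * z))" for z
        by (simp add: v_def w_def inner_complex_def algebra_simps)
      have "inner v (\<mu> i) < 0" if "i \<in> J" for i
      proof -
        have i: "i \<in> N" "i \<notin> S" using that J(1) by (auto simp: N_def)
        then have "Re (\<nu> i) = t i * Im (\<nu> i)" "t i \<noteq> c"
          using Im0[OF i(1)] c by (auto simp: t_def)
        then have "inner v (\<mu> i) = \<sigma> * ((t i - c) * Im (\<nu> i))"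
          by (simp add: v \<nu>_def algebra_simps)
        also have "\<dots> < 0"
        proof (cases "e i = u")
          case True
          then have "t i - c < 0" using i \<open>t i \<noteq> c\<close> by (auto simp: S_def)
          with True Im0[OF i(1)] show ?thesis
            by (auto simp: \<sigma>_def e_def mult_less_0_iff zero_less_mult_iff)
        next
          case False
          then have "t i - c > 0" using i \<open>t i \<noteq> c\<close> by (auto simp: S_def)
          with False Im0[OF i(1)] show ?thesis
            by (auto simp: \<sigma>_def e_def mult_less_0_iff zero_less_mult_iff)
        qed
        finally show ?thesis .
      qed
      then have "convex hull (\<mu> ` J) \<subseteq> {z. inner v z < 0}"
        by (intro hull_minimal convex_halfspace_lt) auto
      moreover have "0 \<in> convex hull (\<mu> ` J)" using J by (intro hull) auto
      ultimately show False by auto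
    qed
    then show "k - card Z \<le> card {i \<in> N. if e i = u then c < t i else t i < c}"
      by (simp add: S_def)
  qed
  moreover have "isotropic Z \<nu> (card Z)"
    using fin by (intro isotropic_zeros) (auto simp: Z_def \<nu>_def)
  ultimately have "isotropic (N \<union> Z) \<nu> (k - card Z + card Z)"
    using fin by (intro isotropic_Un) (auto simp: N_def Z_def)
  moreover have "N \<union> Z = I" by (auto simp: N_def Z_def)
  ultimately have "isotropic I \<nu> k" using isotropic_mono by (metis le_diff_conv order_refl)
  then show ?thesis using w0 unfolding \<nu>_def by (rule isotropic_scale)
qed

lemma homogeneous_solution:
  fixes x :: "nat \<Rightarrow> 'i \<Rightarrow> complex"
  assumes "finite B" and "card B < k"
  obtains c where "\<exists>a<k. c a \<noteq> 0" "\<And>i. i \<in> B \<Longrightarrow> (\<Sum>a<k. c a * x a i) = 0"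
proof -
  obtain bs where bs: "set bs = B" "distinct bs"
    using finite_distinct_list[OF assms(1)] by blast
  then have len: "length bs < k" using assms(2) distinct_card by fastforce
  define M where "M = mat k k (\<lambda>(j, a). if j < length bs then x a (bs ! j) else 0)"
  have M: "M \<in> carrier_mat k k" by (simp add: M_def)
  have "M = mat\<^sub>r k k (\<lambda>j. if j = k - 1 then 0\<^sub>v k else row M j)"
    using len by (intro eq_matI) (auto simp: M_def)
  also have "det \<dots> = 0"
    by (rule det_row_0) (use len M in auto)
  finally have "det M = 0" .
  then obtain v where v: "v \<in> carrier_vec k" "v \<noteq> 0\<^sub>v k" "M *\<^sub>v v = 0\<^sub>v k"
    using det_0_iff_vec_prod_zero_field[OF M] by blast
  show thesis
  proof (rule that[of "\<lambda>a. v $ a"])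
    show "\<exists>a<k. v $ a \<noteq> 0"
      using v(1,2) by (metis carrier_vecD eq_vecI index_zero_vec)
    fix i assume "i \<in> B"
    then obtain j where j: "j < length bs" "i = bs ! j" using bs by (metis in_set_conv_nth)
    have "(M *\<^sub>v v) $ j = 0" using v(3) j len by simp
    moreover have "(M *\<^sub>v v) $ j = (\<Sum>a<k. v $ a * x a i)"
      using j len v(1) by (auto simp: M_def scalar_prod_def lessThan_atLeast0 intro!: sum.cong)
    ultimately show "(\<Sum>a<k. v $ a * x a i) = 0" by simp
  qed
qed

lemma isotropic_imp_hull:
  assumes fin: "finite I" and k: "1 \<le> k" "k \<le> card I"
    and iso: "isotropic I \<mu> k" and J: "J \<subseteq> I" "card J = card I - k + 1"
  shows "0 \<in> convex hull (\<mu> ` J)"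
proof -
  obtain x where x: "\<forall>a<k. \<forall>b<k. (\<Sum>i\<in>I. \<mu> i * cnj (x a i) * x b i) = 0"
    and li: "\<forall>c. (\<forall>i\<in>I. (\<Sum>a<k. c a * x a i) = 0) \<longrightarrow> (\<forall>a<k. c a = 0)"
    using iso unfolding isotropic_def by blast
  have finJ: "finite J" using J(1) fin finite_subset by blast
  have "card (I - J) < k" using J k finJ by (simp add: card_Diff_subset)
  then obtain c where c: "\<exists>a<k. c a \<noteq> 0" "\<And>i. i \<in> I - J \<Longrightarrow> (\<Sum>a<k. c a * x a i) = 0"
    using homogeneous_solution[of "I - J" k x] fin by blast
  define v where "v = (\<lambda>i. \<Sum>a<k. c a * x a i)"
  define W where "W = (\<Sum>i\<in>J. (cmod (v i))\<^sup>2)"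
  obtain i where i: "i \<in> I" "v i \<noteq> 0" using li c(1) unfolding v_def by blast
  then have "i \<in> J" using c(2) unfolding v_def by blast
  have "W > 0"
    unfolding W_def using finJ \<open>i \<in> J\<close> i(2) by (intro sum_pos2[of J i]) auto
  have "(\<Sum>i\<in>J. \<mu> i * complex_of_real ((cmod (v i))\<^sup>2)) = (\<Sum>i\<in>I. \<mu> i * complex_of_real ((cmod (v i))\<^sup>2))"
    using c(2) J(1) fin by (intro sum.mono_neutral_left) (auto simp: v_def)
  also have "\<dots> = (\<Sum>i\<in>I. \<Sum>a<k. \<Sum>b<k. cnj (c a) * c b * (\<mu> i * cnj (x a i) * x b i))"
  proof (rule sum.cong[OF refl])
    fix i
    have "complex_of_real ((cmod (v i))\<^sup>2) = cnj (v i) * v i"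
      using complex_norm_square[of "v i"] by (simp add: mult.commute)
    also have "cnj (v i) = (\<Sum>a<k. cnj (c a * x a i))"
      by (simp add: v_def cnj_sum)
    also have "\<dots> * v i = (\<Sum>a<k. \<Sum>b<k. cnj (c a) * c b * (cnj (x a i) * x b i))"
      unfolding v_def sum_product by (intro sum.cong refl) (simp add: mult_ac)
    finally show "\<mu> i * complex_of_real ((cmod (v i))\<^sup>2) =
        (\<Sum>a<k. \<Sum>b<k. cnj (c a) * c b * (\<mu> i * cnj (x a i) * x b i))"
      by (simp add: sum_distrib_left mult_ac)
  qed
  also have "\<dots> = (\<Sum>a<k. \<Sum>b<k. \<Sum>i\<in>I. cnj (c a) * c b * (\<mu> i * cnj (x a i) * x b i))"
    by (subst sum.swap) (intro sum.cong refl sum.swap)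
  also have "\<dots> = 0"
    using x by (simp flip: sum_distrib_left)
  finally have 0: "(\<Sum>i\<in>J. \<mu> i * complex_of_real ((cmod (v i))\<^sup>2)) = 0" .
  have "(\<Sum>i\<in>J. ((cmod (v i))\<^sup>2 / W) *\<^sub>R \<mu> i) \<in> convex hull (\<mu> ` J)"
  proof (rule convex_sum[OF finJ convex_convex_hull])
    show "(\<Sum>i\<in>J. (cmod (v i))\<^sup>2 / W) = 1"
      using \<open>W > 0\<close> by (simp add: W_def flip: sum_divide_distrib)
    show "(cmod (v i))\<^sup>2 / W \<ge> 0" if "i \<in> J" for i using \<open>W > 0\<close> by simp
    show "\<mu> i \<in> convex hull (\<mu> ` J)" if "i \<in> J" for i using that by (simp add: hull_inc)
  qed
  also have "(\<Sum>i\<in>J. ((cmod (v i))\<^sup>2 / W) *\<^sub>R \<mu> i) =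
      (\<Sum>i\<in>J. \<mu> i * complex_of_real ((cmod (v i))\<^sup>2)) / complex_of_real W"
    by (simp add: sum_divide_distrib scaleR_conv_of_real mult_ac)
  finally show ?thesis using 0 by simp
qed

section \<open>Matrices with orthonormal columns\<close>

lemma mat_adjoint_dim [simp]:
  "dim_row (mat_adjoint A) = dim_col A" "dim_col (mat_adjoint A) = dim_row A"
  by (simp_all add: mat_adjoint_def)

lemma mat_adjoint_carrier:
  "A \<in> carrier_mat n m \<Longrightarrow> mat_adjoint A \<in> carrier_mat m n"
  by (intro carrier_matI) auto

lemma mat_adjoint_index [simp]:
  "i < dim_col A \<Longrightarrow> j < dim_row A \<Longrightarrow> mat_adjoint A $$ (i, j) = conjugate (A $$ (j, i))"
  by (simp add: mat_adjoint_def mat_of_rows_def)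

lemma mat_adjoint_mult:
  fixes A B :: "complex mat"
  assumes "A \<in> carrier_mat n m" and "B \<in> carrier_mat m p"
  shows "mat_adjoint (A * B) = mat_adjoint B * mat_adjoint A"
  using assms by (intro eq_matI) (auto simp: scalar_prod_def cnj_sum mult.commute intro!: sum.cong)

lemma mat_adjoint_adjoint [simp]: "mat_adjoint (mat_adjoint (A :: complex mat)) = A"
  by (intro eq_matI) auto

definition inj_mat :: "'a :: semiring_0 mat \<Rightarrow> bool" where
  "inj_mat X \<longleftrightarrow> (\<forall>v\<in>carrier_vec (dim_col X). X *\<^sub>v v = 0\<^sub>v (dim_row X) \<longrightarrow> v = 0\<^sub>v (dim_col X))"

lemma inj_mat_if_left_inverse:
  fixes X :: "'a :: comm_ring_1 mat"
  assumes X: "X \<in> carrier_mat n k" and Y: "Y \<in> carrier_mat k n" and "Y * X = 1\<^sub>m k"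
  shows "inj_mat X"
  unfolding inj_mat_def
proof (intro ballI impI)
  fix v assume "v \<in> carrier_vec (dim_col X)" and 0: "X *\<^sub>v v = 0\<^sub>v (dim_row X)"
  then have v: "v \<in> carrier_vec k" using X by simp
  have "v = (Y * X) *\<^sub>v v" using assms v by simp
  also have "\<dots> = Y *\<^sub>v (X *\<^sub>v v)" using X Y v by simp
  also have "\<dots> = 0\<^sub>v k" unfolding 0 using X Y by auto
  finally show "v = 0\<^sub>v (dim_col X)" using X by simp
qed

lemma inj_mat_distinct_cols:
  fixes X :: "complex mat"
  assumes X: "X \<in> carrier_mat n k" and inj: "inj_mat X"
  shows "distinct (cols X)"
proof (rule ccontr)
  assume "\<not> distinct (cols X)"
  then obtain i j where ij: "i < k" "j < k" "i \<noteq> j" "col X i = col X j"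
    using X by (auto simp: distinct_conv_nth)
  let ?v = "unit_vec k i - unit_vec k j :: complex vec"
  have unit: "X *\<^sub>v unit_vec k l = col X l" if "l < k" for l
    using X that by (intro eq_vecI) auto
  have "X *\<^sub>v ?v = X *\<^sub>v unit_vec k i - X *\<^sub>v unit_vec k j"
    using X by (intro mult_minus_distrib_mat_vec) auto
  also have "\<dots> = 0\<^sub>v n"
    using X ij by (simp add: unit)
  finally have "?v = 0\<^sub>v k" using inj X by (simp add: inj_mat_def)
  then have "?v $ i = 0" using ij by simp
  with ij show False by simp
qed

lemma inj_mat_lin_indpt:
  fixes X :: "complex mat"
  assumes X: "X \<in> carrier_mat n k" and inj: "inj_mat X"
  shows "\<not> module.lin_dep class_ring (module_vec TYPE(complex) n) (set (cols X))"
proof -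
  interpret vec_space "TYPE(complex)" n .
  show ?thesis
    using lin_depE[OF X _ inj_mat_distinct_cols[OF assms]] inj X unfolding inj_mat_def
    by (metis carrier_matD)
qed

lemma inj_mat_of_cols:
  fixes bs :: "complex vec list"
  assumes "set bs \<subseteq> carrier_vec n" and "distinct bs"
    and "\<not> module.lin_dep class_ring (module_vec TYPE(complex) n) (set bs)"
  shows "inj_mat (mat_of_cols n bs)"
proof -
  interpret vec_space "TYPE(complex)" n .
  show ?thesis
    using lin_depI[of "mat_of_cols n bs" "length bs"] assms cols_mat_of_cols[OF assms(1)]
    unfolding inj_mat_def by auto
qed

lemma orthonormal_cols:
  fixes X :: "complex mat"
  assumes X: "X \<in> carrier_mat n k" and inj: "inj_mat X"
  obtains W R where "W \<in> carrier_mat n k" "R \<in> carrier_mat k k" "W = X * R"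
    "mat_adjoint W * W = 1\<^sub>m k" "\<And>v vs. cols X = v # vs \<Longrightarrow> \<exists>c. col W 0 = c \<cdot>\<^sub>v v"
proof -
  interpret cof_vec_space n "TYPE(complex)" .
  define ws where "ws = gram_schmidt n (cols X)"
  have cX: "set (cols X) \<subseteq> carrier_vec n" using X cols_dim by blast
  note gs = gram_schmidt_result[OF cX inj_mat_distinct_cols[OF assms] inj_mat_lin_indpt[OF assms] ws_def]
  have len: "length ws = k" using gs(4) X by simp
  have wc: "ws ! j \<in> carrier_vec n" if "j < k" for j using gs(3) len that by auto
  have "\<exists>v\<in>carrier_vec k. ws ! j = X *\<^sub>v v" if "j < k" for j
  proof -
    have "ws ! j \<in> span (set (cols X))"
    proof -
      have "set ws \<subseteq> span (set ws)" using gs(3) by (intro in_own_span) simp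
      moreover have "ws ! j \<in> set ws" using len that by simp
      ultimately show ?thesis unfolding gs(1) by blast
    qed
    then have "ws ! j \<in> span_list (cols X)" by (simp only: span_list_as_span[OF cX])
    then obtain c where "ws ! j = lincomb_list c (cols X)" by (rule in_span_listE)
    also have "\<dots> = mat_of_cols n (cols X) *\<^sub>v vec k c"
      using cX X by (subst lincomb_list_as_mat_mult) auto
    also have "mat_of_cols n (cols X) = X" using X by auto
    finally show ?thesis by auto
  qed
  then obtain f where f: "\<And>j. j < k \<Longrightarrow> f j \<in> carrier_vec k" "\<And>j. j < k \<Longrightarrow> ws ! j = X *\<^sub>v f j"
    by metis
  define N where "N = (\<lambda>j. complex_of_real (sqrt (Re (ws ! j \<bullet>c ws ! j))))"
  have N: "N j * N j = ws ! j \<bullet>c ws ! j" "N j \<noteq> 0" "cnj (N j) = N j" if j: "j < k" for j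
  proof -
    have "ws ! j \<bullet>c ws ! j \<ge> 0" "ws ! j \<bullet>c ws ! j \<noteq> 0"
      using corthogonalD[OF gs(2), of j j] len j by (auto intro: conjugate_square_ge_0_vec)
    then show "N j * N j = ws ! j \<bullet>c ws ! j" "N j \<noteq> 0" "cnj (N j) = N j"
      by (auto simp: N_def less_eq_complex_def complex_eq_iff simp flip: of_real_mult)
  qed
  define W where "W = mat n k (\<lambda>(i, j). ws ! j $ i / N j)"
  define R where "R = mat k k (\<lambda>(i, j). f j $ i / N j)"
  show thesis
  proof (rule that[of W R])
    show "W \<in> carrier_mat n k" "R \<in> carrier_mat k k" by (simp_all add: W_def R_def)
    show "W = X * R"
    proof (rule eq_matI)
      fix i j assume "i < dim_row (X * R)" "j < dim_col (X * R)"
      then have ij: "i < n" "j < k" using X by (auto simp: R_def)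
      have "ws ! j $ i = (\<Sum>l = 0..<k. X $$ (i, l) * f j $ l)"
        using f[OF ij(2)] X ij by (auto simp: scalar_prod_def)
      then show "W $$ (i, j) = (X * R) $$ (i, j)"
        using X ij by (simp add: W_def R_def scalar_prod_def sum_divide_distrib)
    qed (use X in \<open>auto simp: W_def R_def\<close>)
    show "mat_adjoint W * W = 1\<^sub>m k"
    proof (rule eq_matI)
      fix a b assume "a < dim_row (1\<^sub>m k :: complex mat)" "b < dim_col (1\<^sub>m k :: complex mat)"
      then have ab: "a < k" "b < k" by auto
      have "(mat_adjoint W * W) $$ (a, b) = (\<Sum>i = 0..<n. ws ! b $ i * cnj (ws ! a $ i) / (N b * N a))"
        using ab N(3) by (simp add: W_def scalar_prod_def mult.commute)
      also have "\<dots> = (ws ! b \<bullet>c ws ! a) / (N b * N a)"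
        using wc[OF ab(1)] wc[OF ab(2)] by (simp add: scalar_prod_def sum_divide_distrib)
      also have "\<dots> = (1\<^sub>m k) $$ (a, b)"
        using corthogonalD[OF gs(2), of b a] len ab N(1)[of a] N(2)[of a] by auto
      finally show "(mat_adjoint W * W) $$ (a, b) = (1\<^sub>m k) $$ (a, b)" .
    qed (auto simp: W_def)
    fix v vs assume v: "cols X = v # vs"
    then have "0 < k" "v \<in> carrier_vec n" using X cX by (auto simp flip: cols_length)
    then have "hd ws = v" by (simp add: ws_def v)
    then have "ws ! 0 = v" using \<open>0 < k\<close> len by (cases ws) auto
    then have "col W 0 = (1 / N 0) \<cdot>\<^sub>v v"
      using \<open>0 < k\<close> \<open>v \<in> carrier_vec n\<close> by (intro eq_vecI) (auto simp: W_def)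
    then show "\<exists>c. col W 0 = c \<cdot>\<^sub>v v" ..
  qed
qed

lemma unitary_first_column:
  fixes v :: "complex vec"
  assumes v: "v \<in> carrier_vec n" and v0: "v \<noteq> 0\<^sub>v n"
  obtains W c where "W \<in> carrier_mat n n" "mat_adjoint W * W = 1\<^sub>m n" "W * mat_adjoint W = 1\<^sub>m n"
    "col W 0 = c \<cdot>\<^sub>v v"
proof -
  interpret vec_space "TYPE(complex)" n .
  define b where "b = basis_completion v"
  note b = basis_completion[OF v v0, folded b_def]
  define X where "X = mat_of_cols n b"
  have X: "X \<in> carrier_mat n n" using b(6) by (simp add: X_def carrier_matI)
  have inj: "inj_mat X" unfolding X_def by (rule inj_mat_of_cols[OF b(2,4,5)])
  have "n \<noteq> 0" using v v0 by auto
  then obtain vs where "b = v # vs" using b(6,7) by (cases b) auto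
  then have cols: "cols X = v # vs" using b(2) by (simp add: X_def)
  obtain W R where W: "W \<in> carrier_mat n n" "mat_adjoint W * W = 1\<^sub>m n"
    "\<And>v vs. cols X = v # vs \<Longrightarrow> \<exists>c. col W 0 = c \<cdot>\<^sub>v v"
    using orthonormal_cols[OF X inj] by metis
  moreover have "W * mat_adjoint W = 1\<^sub>m n"
    by (rule mat_mult_left_right_inverse[OF mat_adjoint_carrier[OF W(1)] W(1,2)])
  ultimately show thesis using that cols by blast
qed

lemma span_cols_mult_subset:
  fixes B C :: "complex mat"
  assumes B: "B \<in> carrier_mat n m" and C: "C \<in> carrier_mat m p"
  shows "LinearCombinations.module.span class_ring (module_vec TYPE(complex) n) (set (cols (B * C)))
    \<subseteq> LinearCombinations.module.span class_ring (module_vec TYPE(complex) n) (set (cols B))"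
proof -
  interpret vec_space "TYPE(complex)" n .
  have cB: "set (cols B) \<subseteq> carrier_vec n" using B cols_dim by blast
  have "col (B * C) j \<in> span (set (cols B))" if j: "j < p" for j
  proof -
    have "col (B * C) j = B *\<^sub>v col C j" using B C j by (intro eq_vecI) auto
    also have "\<dots> = lincomb_list (\<lambda>l. col C j $ l) (cols B)"
    proof -
      have "vec m (\<lambda>l. col C j $ l) = col C j" using C j by (intro eq_vecI) auto
      moreover have "mat_of_cols n (cols B) = B" using B by auto
      ultimately show ?thesis
        using cB B by (subst lincomb_list_as_mat_mult) auto
    qed
    also have "\<dots> \<in> span_list (cols B)" by (intro in_span_listI) auto
    also have "\<dots> = span (set (cols B))" by (rule span_list_as_span[OF cB])
    finally show ?thesis .
  qed
  then have "set (cols (B * C)) \<subseteq> span (set (cols B))"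
    using C by (auto simp: cols_def)
  then show ?thesis by (rule span_subsetI[OF cB])
qed

lemma rank_projection_onto_orthonormal_cols:
  fixes W :: "complex mat"
  assumes W: "W \<in> carrier_mat n k" and orth: "mat_adjoint W * W = 1\<^sub>m k"
  shows "vec_space.rank n (W * mat_adjoint W) = k"
proof -
  interpret vec_space "TYPE(complex)" n .
  have W': "mat_adjoint W \<in> carrier_mat k n" using W by (simp add: mat_adjoint_carrier)
  have inj: "inj_mat W" by (rule inj_mat_if_left_inverse[OF W W' orth])
  have "W * mat_adjoint W * W = W"
    using W W' orth by (metis assoc_mult_mat right_mult_one_mat)
  then have "span (set (cols W)) \<subseteq> span (set (cols (W * mat_adjoint W)))"
    using span_cols_mult_subset[of "W * mat_adjoint W" n n W k] W W' by simp
  moreover have "span (set (cols (W * mat_adjoint W))) \<subseteq> span (set (cols W))"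
    by (rule span_cols_mult_subset[OF W W'])
  ultimately have "rank (W * mat_adjoint W) = rank W"
    unfolding rank_def by simp
  also have "\<dots> = k"
    by (rule lin_indpt_full_rank[OF W inj_mat_distinct_cols[OF W inj] inj_mat_lin_indpt[OF W inj]])
  finally show ?thesis .
qed

lemma independent_cols_of_projection:
  fixes P :: "complex mat"
  assumes P: "P \<in> carrier_mat n n" and idem: "P * P = P" and rank: "vec_space.rank n P = k"
  obtains X where "X \<in> carrier_mat n k" "inj_mat X" "P * X = X"
proof -
  interpret vec_space "TYPE(complex)" n .
  have cP: "set (cols P) \<subseteq> carrier_vec n" using P cols_dim by blast
  have "lin_indpt {}" by (simp add: lin_dep_def)
  then obtain S where S: "maximal S (\<lambda>T. T \<subseteq> set (cols P) \<and> lin_indpt T)"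
    using maximal_exists_superset[of "set (cols P)" "\<lambda>T. T \<subseteq> set (cols P) \<and> lin_indpt T" "{}"]
    by auto
  then have S': "S \<subseteq> set (cols P)" "lin_indpt S" by (auto simp: maximal_def)
  have "card S = k" using rank_card_indpt[OF P S] rank by simp
  moreover obtain bs where bs: "set bs = S" "distinct bs"
    using S'(1) finite_distinct_list finite_subset by (metis List.finite_set)
  ultimately have len: "length bs = k" using distinct_card by fastforce
  have cb: "set bs \<subseteq> carrier_vec n" using bs S' cP by auto
  have "P * mat_of_cols n bs = mat_of_cols n bs"
  proof (rule mat_col_eqI)
    fix j assume "j < dim_col (mat_of_cols n bs)"
    then have j: "j < length bs" by simp
    then obtain i where i: "i < n" "bs ! j = col P i"
      using bs S'(1) P by (metis carrier_matD(2) cols_length cols_nth in_set_conv_nth nth_mem subsetD)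
    have bj: "bs ! j \<in> carrier_vec n" using cb j nth_mem by blast
    have "col (P * mat_of_cols n bs) j = P *\<^sub>v col (mat_of_cols n bs) j"
      using P j by (intro eq_vecI) auto
    also have "col (mat_of_cols n bs) j = col P i" using j bj i(2) by simp
    also have "P *\<^sub>v col P i = col (P * P) i" using P i(1) by (intro eq_vecI) auto
    also have "\<dots> = col (mat_of_cols n bs) j" using idem j bj i(2) by simp
    finally show "col (P * mat_of_cols n bs) j = col (mat_of_cols n bs) j" .
  qed (use P in auto)
  moreover have "mat_of_cols n bs \<in> carrier_mat n k" using len by auto
  moreover have "inj_mat (mat_of_cols n bs)"
    by (rule inj_mat_of_cols) (use cb bs S'(2) in auto)
  ultimately show thesis using that by blast
qed

lemma rank_numerical_range_iff:
  fixes A :: "complex mat"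
  assumes A: "A \<in> carrier_mat n n"
  shows "\<mu> \<in> rank_numerical_range k A \<longleftrightarrow>
    (\<exists>X\<in>carrier_mat n k. inj_mat X \<and> mat_adjoint X * (A * X) = \<mu> \<cdot>\<^sub>m (mat_adjoint X * X))"
    (is "_ \<longleftrightarrow> ?R")
proof
  assume "\<mu> \<in> rank_numerical_range k A"
  then obtain P where P: "P \<in> carrier_mat n n" "P * P = P" "mat_adjoint P = P"
    "vec_space.rank n P = k" "P * A * P = \<mu> \<cdot>\<^sub>m P"
    using A by (auto simp: rank_numerical_range_def orthogonal_projection_def)
  obtain X where X: "X \<in> carrier_mat n k" "inj_mat X" "P * X = X"
    using independent_cols_of_projection[OF P(1,2,4)] .
  have X': "mat_adjoint X \<in> carrier_mat k n" using X by (simp add: mat_adjoint_carrier)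
  have "mat_adjoint X = mat_adjoint X * P"
    using mat_adjoint_mult[OF P(1) X(1)] X(3) P(3) by simp
  then have "mat_adjoint X * (A * X) = mat_adjoint X * P * (A * (P * X))"
    using X(3) by simp
  also have "\<dots> = mat_adjoint X * (P * A * P * X)"
    using A P(1) X(1) X' by (simp add: assoc_mult_mat[of _ _ n _ n _ k] assoc_mult_mat[of _ _ n _ n _ n]
      assoc_mult_mat[of _ k n _ n _ k])
  also have "\<dots> = \<mu> \<cdot>\<^sub>m (mat_adjoint X * (P * X))"
    unfolding P(5) using P(1) X(1) X' by (simp add: mult_smult_assoc_mat[of _ n n _ k] mult_smult_distrib[of _ k n _ k])
  finally show ?R using X by auto
next
  assume ?R
  then obtain X where X: "X \<in> carrier_mat n k" "inj_mat X"
    "mat_adjoint X * (A * X) = \<mu> \<cdot>\<^sub>m (mat_adjoint X * X)" by blast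
  obtain W R where W: "W \<in> carrier_mat n k" "R \<in> carrier_mat k k" "W = X * R" "mat_adjoint W * W = 1\<^sub>m k"
    using orthonormal_cols[OF X(1,2)] by metis
  have W': "mat_adjoint W \<in> carrier_mat k n" and X': "mat_adjoint X \<in> carrier_mat k n"
    and R': "mat_adjoint R \<in> carrier_mat k k" using W X by (simp_all add: mat_adjoint_carrier)
  note adjW = mat_adjoint_mult[OF X(1) W(2), folded W(3)]
  have "mat_adjoint W * (A * W) = mat_adjoint R * mat_adjoint X * (A * (X * R))"
    by (simp only: adjW) (simp only: W(3))
  also have "\<dots> = mat_adjoint R * (mat_adjoint X * (A * X)) * R"
    using A X(1) X' W(2) R' by (simp add: assoc_mult_mat[of _ k k _ n _ k] assoc_mult_mat[of _ n n _ k _ k]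
      assoc_mult_mat[of _ k n _ k _ k] assoc_mult_mat[of _ k k _ k _ k])
  also have "\<dots> = \<mu> \<cdot>\<^sub>m (mat_adjoint R * (mat_adjoint X * X) * R)"
    unfolding X(3) using X(1) X' W(2) R' by (simp add: mult_smult_assoc_mat[of _ k k _ k] mult_smult_distrib[of _ k k _ k])
  also have "mat_adjoint R * (mat_adjoint X * X) * R = mat_adjoint R * mat_adjoint X * (X * R)"
    using X(1) X' W(2) R' by (simp add: assoc_mult_mat[of _ k k _ n _ k]
      assoc_mult_mat[of _ k n _ k _ k] assoc_mult_mat[of _ k k _ k _ k])
  also have "\<dots> = 1\<^sub>m k"
    using W(4) unfolding adjW W(3)[symmetric] .
  finally have AW: "mat_adjoint W * (A * W) = \<mu> \<cdot>\<^sub>m 1\<^sub>m k" .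
  define P where "P = W * mat_adjoint W"
  have P: "P \<in> carrier_mat n n" using W(1) W' by (simp add: P_def)
  have "P * P = W * (mat_adjoint W * W) * mat_adjoint W"
    using W(1) W' by (simp add: P_def assoc_mult_mat[of _ n k _ n _ n] assoc_mult_mat[of _ k n _ k _ n]
      assoc_mult_mat[of _ n k _ k _ n])
  then have "P * P = P" using W(1,4) by (simp add: P_def)
  moreover have "mat_adjoint P = P"
    unfolding P_def using mat_adjoint_mult[OF W(1) W'] by simp
  moreover have "P * A * P = W * (mat_adjoint W * (A * W)) * mat_adjoint W"
    using W(1) W' A by (simp add: P_def assoc_mult_mat[of _ n k _ n _ n] assoc_mult_mat[of _ k n _ k _ n]
      assoc_mult_mat[of _ n k _ k _ n] assoc_mult_mat[of _ n n _ k _ n] assoc_mult_mat[of _ n n _ n _ n]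
      assoc_mult_mat[of _ k n _ n _ n])
  then have "P * A * P = \<mu> \<cdot>\<^sub>m P"
    unfolding AW using W(1) W' by (simp add: P_def mult_smult_assoc_mat[of _ n k _ n] mult_smult_distrib[of _ n k _ k])
  moreover have "vec_space.rank n P = k"
    unfolding P_def by (rule rank_projection_onto_orthonormal_cols[OF W(1,4)])
  ultimately show "\<mu> \<in> rank_numerical_range k A"
    using A P by (auto simp: rank_numerical_range_def orthogonal_projection_def)
qed

lemma normal_first_row_zero:
  fixes B :: "complex mat"
  assumes B: "B \<in> carrier_mat n n" and "normal_mat B"
    and col: "\<And>i. 0 < i \<Longrightarrow> i < n \<Longrightarrow> B $$ (i, 0) = 0"
    and j: "0 < j" "j < n"
  shows "B $$ (0, j) = 0"
proof -
  have n: "0 < n" using j by simp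
  have "(\<Sum>l = 0..<n. B $$ (0, l) * cnj (B $$ (0, l))) = (B * mat_adjoint B) $$ (0, 0)"
    using B n by (simp add: scalar_prod_def)
  also have "\<dots> = (mat_adjoint B * B) $$ (0, 0)"
    using assms(2) by (simp add: normal_mat_def)
  also have "\<dots> = (\<Sum>l = 0..<n. cnj (B $$ (l, 0)) * B $$ (l, 0))"
    using B n by (simp add: scalar_prod_def)
  also have "\<dots> = cnj (B $$ (0, 0)) * B $$ (0, 0)"
    using n col by (subst sum.remove[of _ 0]) auto
  finally have "(\<Sum>l\<in>{0..<n} - {0}. B $$ (0, l) * cnj (B $$ (0, l))) = 0"
    using n by (subst (asm) sum.remove[of _ 0]) auto
  then have "(\<Sum>l\<in>{0..<n} - {0}. complex_of_real ((cmod (B $$ (0, l)))\<^sup>2)) = 0"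
    by (simp only: complex_norm_square)
  then have "(\<Sum>l\<in>{0..<n} - {0}. (cmod (B $$ (0, l)))\<^sup>2) = 0"
    by (simp only: of_real_sum[symmetric] of_real_eq_0_iff)
  then have "(cmod (B $$ (0, j)))\<^sup>2 = 0"
    by (subst (asm) sum_nonneg_eq_0_iff) (use j in auto)
  then show ?thesis by simp
qed

lemma normal_unitary_diagonalization:
  fixes A :: "complex mat"
  assumes "A \<in> carrier_mat n n" and "normal_mat A" and "char_poly A = (\<Prod>e\<leftarrow>es. [:- e, 1:])"
  shows "\<exists>U\<in>carrier_mat n n. mat_adjoint U * U = 1\<^sub>m n \<and>
    A * U = U * mat n n (\<lambda>(i, j). if i = j then es ! i else 0)"
  using assms
proof (induction es arbitrary: n A)
  case Nil
  then have "n = 0" using degree_monic_char_poly[of A n] by simp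
  with Nil.prems(1) show ?case by (intro bexI[of _ "1\<^sub>m 0"]) (auto intro!: eq_matI)
next
  case (Cons e es n A)
  note A = Cons.prems(1)
  have cp: "char_poly A = [:- e, 1:] * (\<Prod>e\<leftarrow>es. [:- e, 1:])" using Cons.prems(3) by simp
  obtain v where "eigenvector A v e"
    using eigenvalue_root_char_poly[OF A, of e] cp by (auto simp: eigenvalue_def)
  then have v: "v \<in> carrier_vec n" "v \<noteq> 0\<^sub>v n" "A *\<^sub>v v = e \<cdot>\<^sub>v v"
    using A by (auto simp: eigenvector_def)
  then obtain m where n: "n = Suc m" by (cases n) auto
  obtain W c where W: "W \<in> carrier_mat n n" "mat_adjoint W * W = 1\<^sub>m n" "W * mat_adjoint W = 1\<^sub>m n"
    "col W 0 = c \<cdot>\<^sub>v v"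
    using unitary_first_column[OF v(1,2)] by metis
  have W': "mat_adjoint W \<in> carrier_mat n n" using W by (simp add: mat_adjoint_carrier)
  define B where "B = mat_adjoint W * (A * W)"
  have B: "B \<in> carrier_mat n n" unfolding B_def by (rule mult_carrier_mat[OF W' mult_carrier_mat[OF A W(1)]])
  have WB: "A * W = W * B"
    unfolding B_def using W A assoc_mult_mat[OF W(1) W' mult_carrier_mat[OF A W(1)]] by simp
  have B0: "B $$ (i, 0) = (if i = 0 then e else 0)" if i: "i < n" for i
  proof -
    have W0: "col W 0 \<in> carrier_vec n" unfolding W(4) using v(1) by simp
    have "col B 0 = mat_adjoint W *\<^sub>v (A *\<^sub>v col W 0)"
      unfolding B_def using col_mult2[OF W' mult_carrier_mat[OF A W(1)], of 0] col_mult2[OF A W(1), of 0] n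
      by simp
    also have "A *\<^sub>v col W 0 = e \<cdot>\<^sub>v col W 0"
      unfolding W(4) using v A by (simp add: mult_mat_vec smult_smult_assoc mult.commute)
    also have "mat_adjoint W *\<^sub>v (e \<cdot>\<^sub>v col W 0) = e \<cdot>\<^sub>v (mat_adjoint W *\<^sub>v col W 0)"
      by (rule mult_mat_vec[OF W' W0])
    also have "mat_adjoint W *\<^sub>v col W 0 = col (mat_adjoint W * W) 0"
      using col_mult2[OF W' W(1), of 0] n by simp
    finally have "col B 0 = e \<cdot>\<^sub>v col (1\<^sub>m n) 0"
      unfolding W(2) .
    then have "col B 0 $ i = (e \<cdot>\<^sub>v col (1\<^sub>m n) 0) $ i" by simp
    then show ?thesis using i B n by auto
  qed
  have adjB: "mat_adjoint B = mat_adjoint W * (mat_adjoint A * W)"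
    using mat_adjoint_mult[OF W' mult_carrier_mat[OF A W(1)]] mat_adjoint_mult[OF A W(1)]
      assoc_mult_mat[OF W' mat_adjoint_carrier[OF A] W(1)]
    by (simp only: B_def mat_adjoint_adjoint)
  have mid: "mat_adjoint W * (C * W) * (mat_adjoint W * (D * W)) = mat_adjoint W * (C * D * W)"
    if "C \<in> carrier_mat n n" "D \<in> carrier_mat n n" for C D
  proof -
    have "mat_adjoint W * (C * W) * (mat_adjoint W * (D * W)) =
        mat_adjoint W * (C * (W * mat_adjoint W * (D * W)))"
      using that W(1) W' by (simp add: assoc_mult_mat[of _ n n _ n _ n])
    also have "\<dots> = mat_adjoint W * (C * D * W)"
      using that W by (simp add: assoc_mult_mat[of _ n n _ n _ n])
    finally show ?thesis .
  qed
  have normB: "normal_mat B"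
    using Cons.prems(2) mid[of A "mat_adjoint A"] mid[of "mat_adjoint A" A] A mat_adjoint_carrier[OF A]
    unfolding normal_mat_def adjB by (simp add: B_def)
  have row: "B $$ (0, j) = 0" if "0 < j" "j < n" for j
    using normal_first_row_zero[OF B normB _ that] B0 by simp
  define B3 where "B3 = mat m m (\<lambda>(i, j). B $$ (Suc i, Suc j))"
  have B3: "B3 \<in> carrier_mat m m" by (simp add: B3_def)
  have Bblock: "B = four_block_mat (mat 1 1 (\<lambda>_. e)) (0\<^sub>m 1 m) (0\<^sub>m m 1) B3"
    using B B0 row by (intro eq_matI) (auto simp: n B3_def)
  have "normal_mat B3"
    unfolding normal_mat_def
  proof (rule eq_matI)
    fix i j assume "i < dim_row (mat_adjoint B3 * B3)" "j < dim_col (mat_adjoint B3 * B3)"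
    then have ij: "i < m" "j < m" using B3 by auto
    have "(B * mat_adjoint B) $$ (Suc i, Suc j) = (mat_adjoint B * B) $$ (Suc i, Suc j)"
      using normB by (simp add: normal_mat_def)
    then show "(B3 * mat_adjoint B3) $$ (i, j) = (mat_adjoint B3 * B3) $$ (i, j)"
      using ij B B0 row n
      by (simp add: scalar_prod_def B3_def sum.atLeast0_lessThan_Suc_shift del: sum.op_ivl_Suc)
  qed (use B3 in auto)
  moreover have "char_poly B3 = (\<Prod>e\<leftarrow>es. [:- e, 1:])"
  proof -
    have "similar_mat A B"
      unfolding similar_mat_def
    proof (intro exI)
      have "A = A * (W * mat_adjoint W)" using A W(3) by simp
      also have "\<dots> = A * W * mat_adjoint W" using A W(1) W' by (simp add: assoc_mult_mat[of _ n n _ n _ n])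
      finally have "A = W * B * mat_adjoint W" unfolding WB .
      then show "similar_mat_wit A B W (mat_adjoint W)"
        using A B W(1,2,3) W' by (intro similar_mat_witI[of _ _ n]) auto
    qed
    then have "char_poly A = char_poly B" by (rule char_poly_similar)
    also have "\<dots> = char_poly (mat 1 1 (\<lambda>_. e)) * char_poly B3"
      unfolding Bblock by (rule char_poly_four_block_zeros_col[of _ _ m]) (use B3 in auto)
    also have "char_poly (mat 1 1 (\<lambda>_. e)) = [:- e, 1:]"
      by (simp add: char_poly_defs det_def sign_def)
    finally show ?thesis unfolding cp by (metis mult_cancel_left pCons_eq_0_iff zero_neq_one)
  qed
  ultimately obtain V where V: "V \<in> carrier_mat m m" "mat_adjoint V * V = 1\<^sub>m m"
    "B3 * V = V * mat m m (\<lambda>(i, j). if i = j then es ! i else 0)"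
    using Cons.IH[OF B3] by blast
  define D where "D = mat m m (\<lambda>(i, j). if i = j then es ! i else 0)"
  define Q where "Q = four_block_mat (1\<^sub>m 1) (0\<^sub>m 1 m) (0\<^sub>m m 1) V"
  have Q: "Q \<in> carrier_mat n n" using V(1) by (intro carrier_matI) (auto simp: Q_def n)
  have D: "D \<in> carrier_mat m m" by (simp add: D_def)
  have adjQ: "mat_adjoint Q = four_block_mat (1\<^sub>m 1) (0\<^sub>m 1 m) (0\<^sub>m m 1) (mat_adjoint V)"
    using V by (intro eq_matI) (auto simp: Q_def)
  have QQ: "mat_adjoint Q * Q = 1\<^sub>m n"
    unfolding adjQ unfolding Q_def using V mat_adjoint_carrier[OF V(1)]
    by (subst mult_four_block_mat[of _ 1 1 _ m _ m _ _ 1 _ m]) (auto simp: n)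
  have DD: "mat n n (\<lambda>(i, j). if i = j then (e # es) ! i else 0) =
      four_block_mat (mat 1 1 (\<lambda>_. e)) (0\<^sub>m 1 m) (0\<^sub>m m 1) D"
    by (intro eq_matI) (auto simp: n D_def nth_Cons split: nat.split)
  have BQ: "B * Q = Q * mat n n (\<lambda>(i, j). if i = j then (e # es) ! i else 0)"
  proof -
    have "B * Q = four_block_mat (mat 1 1 (\<lambda>_. e)) (0\<^sub>m 1 m) (0\<^sub>m m 1) (B3 * V)"
      unfolding Bblock Q_def using V B3
      by (subst mult_four_block_mat[of _ 1 1 _ m _ m _ _ 1 _ m]) (auto simp: n)
    also have "\<dots> = Q * four_block_mat (mat 1 1 (\<lambda>_. e)) (0\<^sub>m 1 m) (0\<^sub>m m 1) D"
      unfolding Q_def V(3) D_def[symmetric] using V D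
      by (subst mult_four_block_mat[of _ 1 1 _ m _ m _ _ 1 _ m]) (auto simp: n)
    finally show ?thesis unfolding DD .
  qed
  show ?case
  proof (intro bexI conjI)
    show "W * Q \<in> carrier_mat n n" using W Q by simp
    have "mat_adjoint (W * Q) * (W * Q) = mat_adjoint Q * (mat_adjoint W * W * Q)"
      using mat_adjoint_mult[OF W(1) Q] W(1) W' Q mat_adjoint_carrier[OF Q] by (simp add: assoc_mult_mat[of _ n n _ n _ n])
    then show "mat_adjoint (W * Q) * (W * Q) = 1\<^sub>m n"
      using W(2) Q QQ by simp
    have "A * (W * Q) = A * W * Q" using A W(1) Q by (simp add: assoc_mult_mat[of _ n n _ n _ n])
    also have "\<dots> = W * (B * Q)" unfolding WB using W(1) B Q by (simp add: assoc_mult_mat[of _ n n _ n _ n])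
    also have "\<dots> = W * Q * mat n n (\<lambda>(i, j). if i = j then (e # es) ! i else 0)"
      unfolding BQ using W(1) Q by (simp add: assoc_mult_mat[of _ n n _ n _ n])
    finally show "A * (W * Q) = W * Q * mat n n (\<lambda>(i, j). if i = j then (e # es) ! i else 0)" .
  qed
qed

lemma inj_mat_mult_unitary_iff:
  fixes U Z :: "complex mat"
  assumes U: "U \<in> carrier_mat n n" and unit: "mat_adjoint U * U = 1\<^sub>m n" and Z: "Z \<in> carrier_mat n k"
  shows "inj_mat (U * Z) \<longleftrightarrow> inj_mat Z"
proof -
  have "(U * Z) *\<^sub>v v = 0\<^sub>v n \<longleftrightarrow> Z *\<^sub>v v = 0\<^sub>v n" if v: "v \<in> carrier_vec k" for v
  proof -
    have "inj_mat U"
      by (rule inj_mat_if_left_inverse[OF U mat_adjoint_carrier[OF U] unit])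
    moreover have "Z *\<^sub>v v \<in> carrier_vec n" using Z v by simp
    moreover have "U *\<^sub>v 0\<^sub>v n = 0\<^sub>v n" using U by auto
    moreover have "(U * Z) *\<^sub>v v = U *\<^sub>v (Z *\<^sub>v v)" using U Z v by simp
    ultimately show ?thesis using U unfolding inj_mat_def by auto
  qed
  then show ?thesis using U Z by (simp add: inj_mat_def)
qed

lemma inj_mat_iff:
  fixes Z :: "complex mat"
  assumes Z: "Z \<in> carrier_mat n k"
  shows "inj_mat Z \<longleftrightarrow>
    (\<forall>c. (\<forall>i<n. (\<Sum>a<k. c a * Z $$ (i, a)) = 0) \<longrightarrow> (\<forall>a<k. c a = 0))"
proof -
  have mult: "(Z *\<^sub>v v) $ i = (\<Sum>a<k. v $ a * Z $$ (i, a))" if "v \<in> carrier_vec k" "i < n" for v i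
    using Z that by (auto simp: scalar_prod_def lessThan_atLeast0 mult.commute intro!: sum.cong)
  show ?thesis
  proof
    assume inj: "inj_mat Z"
    show "\<forall>c. (\<forall>i<n. (\<Sum>a<k. c a * Z $$ (i, a)) = 0) \<longrightarrow> (\<forall>a<k. c a = 0)"
    proof (intro allI impI)
      fix c a assume c: "\<forall>i<n. (\<Sum>a<k. c a * Z $$ (i, a)) = 0" and a: "a < k"
      have "Z *\<^sub>v vec k c = 0\<^sub>v n"
        using Z c mult[of "vec k c"] by (intro eq_vecI) auto
      then have "vec k c = 0\<^sub>v k" using inj Z by (auto simp: inj_mat_def)
      then have "vec k c $ a = 0" using a by simp
      then show "c a = 0" using a by simp
    qed
  next
    assume li: "\<forall>c. (\<forall>i<n. (\<Sum>a<k. c a * Z $$ (i, a)) = 0) \<longrightarrow> (\<forall>a<k. c a = 0)"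
    show "inj_mat Z"
      unfolding inj_mat_def
    proof (intro ballI impI)
      fix v assume "v \<in> carrier_vec (dim_col Z)" and 0: "Z *\<^sub>v v = 0\<^sub>v (dim_row Z)"
      then have v: "v \<in> carrier_vec k" using Z by simp
      have "(\<Sum>a<k. v $ a * Z $$ (i, a)) = 0" if "i < n" for i
        using mult[OF v that] 0 Z that by simp
      with li have "\<forall>a<k. v $ a = 0" by blast
      then show "v = 0\<^sub>v (dim_col Z)" using v Z by (intro eq_vecI) auto
    qed
  qed
qed

lemma rank_numerical_range_normal_iff_isotropic:
  fixes A :: "complex mat"
  assumes A: "A \<in> carrier_mat n n" and "normal_mat A"
    and cp: "char_poly A = (\<Prod>j = 1..n. [:- ev j, 1:])"
  shows "\<mu> \<in> rank_numerical_range k A \<longleftrightarrow> isotropic {1..n} (\<lambda>j. ev j - \<mu>) k"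
proof -
  define es where "es = map ev [1..<Suc n]"
  have "char_poly A = (\<Prod>e\<leftarrow>es. [:- e, 1:])"
    unfolding cp es_def by (simp add: prod.distinct_set_conv_list[symmetric] o_def atLeastLessThanSuc_atLeastAtMost del: upt_Suc)
  from normal_unitary_diagonalization[OF A assms(2) this] obtain U where
    U: "U \<in> carrier_mat n n" "mat_adjoint U * U = 1\<^sub>m n"
    and AU: "A * U = U * mat n n (\<lambda>(i, j). if i = j then es ! i else 0)" by blast
  define D where "D = mat n n (\<lambda>(i, j). if i = j then es ! i else 0)"
  have D: "D \<in> carrier_mat n n" by (simp add: D_def)
  have U': "mat_adjoint U \<in> carrier_mat n n" using U by (simp add: mat_adjoint_carrier)
  have UU': "U * mat_adjoint U = 1\<^sub>m n"
    by (rule mat_mult_left_right_inverse[OF U' U(1,2)])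
  have es: "es ! i = ev (Suc i)" if "i < n" for i using that by (simp add: es_def del: upt_Suc)
  have shift: "sum f {1..n} = (\<Sum>i = 0..<n. f (Suc i))" for f :: "nat \<Rightarrow> complex"
    by (simp add: sum.atLeast1_atMost_eq lessThan_atLeast0)
  have iff: "inj_mat (U * Z) \<and> mat_adjoint (U * Z) * (A * (U * Z)) = \<mu> \<cdot>\<^sub>m (mat_adjoint (U * Z) * (U * Z)) \<longleftrightarrow>
     inj_mat Z \<and> (\<forall>a<k. \<forall>b<k. (\<Sum>j = 1..n. (ev j - \<mu>) * cnj (Z $$ (j - 1, a)) * Z $$ (j - 1, b)) = 0)"
    if Z: "Z \<in> carrier_mat n k" for Z
  proof -
    have Z': "mat_adjoint Z \<in> carrier_mat k n" using Z by (simp add: mat_adjoint_carrier)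
    have "mat_adjoint (U * Z) * (A * (U * Z)) = mat_adjoint Z * (mat_adjoint U * U * (D * Z))"
    proof -
      have "A * (U * Z) = U * (D * Z)"
      proof -
        have "A * (U * Z) = A * U * Z" by (rule assoc_mult_mat[OF A U(1) Z, symmetric])
        also have "\<dots> = U * (D * Z)"
          unfolding AU[folded D_def] by (rule assoc_mult_mat[OF U(1) D Z])
        finally show ?thesis .
      qed
      then show ?thesis
        using mat_adjoint_mult[OF U(1) Z] U(1) U' Z Z' D
        by (simp add: assoc_mult_mat[of _ k n _ n _ k] assoc_mult_mat[of _ n n _ n _ k])
    qed
    moreover have "mat_adjoint (U * Z) * (U * Z) = mat_adjoint Z * (mat_adjoint U * U * Z)"
      using mat_adjoint_mult[OF U(1) Z] U(1) U' Z Z'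
      by (simp add: assoc_mult_mat[of _ k n _ n _ k] assoc_mult_mat[of _ n n _ n _ k])
    ultimately have "mat_adjoint (U * Z) * (A * (U * Z)) = \<mu> \<cdot>\<^sub>m (mat_adjoint (U * Z) * (U * Z)) \<longleftrightarrow>
        mat_adjoint Z * (D * Z) = \<mu> \<cdot>\<^sub>m (mat_adjoint Z * Z)"
      using U(2) Z D by simp
    also have "\<dots> \<longleftrightarrow> (\<forall>a<k. \<forall>b<k. (mat_adjoint Z * (D * Z)) $$ (a, b) = (\<mu> \<cdot>\<^sub>m (mat_adjoint Z * Z)) $$ (a, b))"
      using Z by (auto simp: mat_eq_iff)
    also have "\<dots> \<longleftrightarrow> (\<forall>a<k. \<forall>b<k. (\<Sum>j = 1..n. (ev j - \<mu>) * cnj (Z $$ (j - 1, a)) * Z $$ (j - 1, b)) = 0)"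
    proof (intro all_cong1 imp_cong refl)
      fix a b assume ab: "a < k" "b < k"
      have DZ: "(D * Z) $$ (i, b) = ev (Suc i) * Z $$ (i, b)" if "i < n" for i
      proof -
        have "(D * Z) $$ (i, b) = (\<Sum>l = 0..<n. (if i = l then es ! i else 0) * Z $$ (l, b))"
          using Z ab that by (simp add: D_def scalar_prod_def)
        also have "\<dots> = (\<Sum>l = 0..<n. if l = i then es ! i * Z $$ (i, b) else 0)"
          by (intro sum.cong) auto
        finally show ?thesis using that es by simp
      qed
      have "(mat_adjoint Z * (D * Z)) $$ (a, b) - (\<mu> \<cdot>\<^sub>m (mat_adjoint Z * Z)) $$ (a, b) =
          (\<Sum>i = 0..<n. cnj (Z $$ (i, a)) * (D * Z) $$ (i, b)) - \<mu> * (\<Sum>i = 0..<n. cnj (Z $$ (i, a)) * Z $$ (i, b))"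
        using Z D ab by (simp add: scalar_prod_def)
      also have "\<dots> = (\<Sum>i = 0..<n. (ev (Suc i) - \<mu>) * cnj (Z $$ (i, a)) * Z $$ (i, b))"
        by (simp add: sum_distrib_left DZ sum_subtractf[symmetric] algebra_simps)
      also have "\<dots> = (\<Sum>j = 1..n. (ev j - \<mu>) * cnj (Z $$ (j - 1, a)) * Z $$ (j - 1, b))"
        by (simp only: shift diff_Suc_1)
      finally have diff: "(mat_adjoint Z * (D * Z)) $$ (a, b) - (\<mu> \<cdot>\<^sub>m (mat_adjoint Z * Z)) $$ (a, b) =
          (\<Sum>j = 1..n. (ev j - \<mu>) * cnj (Z $$ (j - 1, a)) * Z $$ (j - 1, b))" .
      show "(mat_adjoint Z * (D * Z)) $$ (a, b) = (\<mu> \<cdot>\<^sub>m (mat_adjoint Z * Z)) $$ (a, b) \<longleftrightarrow>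
          (\<Sum>j = 1..n. (ev j - \<mu>) * cnj (Z $$ (j - 1, a)) * Z $$ (j - 1, b)) = 0"
        unfolding diff[symmetric] by (rule eq_iff_diff_eq_0)
    qed
    finally show ?thesis using inj_mat_mult_unitary_iff[OF U Z] by simp
  qed
  have all: "(\<forall>i\<in>{1..n}. P (i - 1)) \<longleftrightarrow> (\<forall>i<n. P i)" for P :: "nat \<Rightarrow> bool"
  proof (intro iffI ballI allI impI)
    fix i assume "\<forall>i\<in>{1..n}. P (i - 1)" and "i < n"
    then show "P i" by (auto dest: bspec[of _ _ "Suc i"])
  next
    fix i assume "\<forall>i<n. P i" and "i \<in> {1..n}"
    then show "P (i - 1)" by (auto dest: spec[of _ "i - 1"])
  qed
  show ?thesis
    unfolding rank_numerical_range_iff[OF A]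
  proof
    assume "\<exists>X\<in>carrier_mat n k. inj_mat X \<and> mat_adjoint X * (A * X) = \<mu> \<cdot>\<^sub>m (mat_adjoint X * X)"
    then obtain X where X: "X \<in> carrier_mat n k" "inj_mat X"
      "mat_adjoint X * (A * X) = \<mu> \<cdot>\<^sub>m (mat_adjoint X * X)" by blast
    define Z where "Z = mat_adjoint U * X"
    have Z: "Z \<in> carrier_mat n k" using U' X(1) by (simp add: Z_def)
    have "U * Z = X"
      unfolding Z_def using assoc_mult_mat[OF U(1) U' X(1)] UU' X(1) by simp
    note Z_iff = iff[OF Z, unfolded this, THEN iffD1, OF conjI[OF X(2,3)]]
    note inj = Z_iff[THEN conjunct1] and 0 = Z_iff[THEN conjunct2]
    show "isotropic {1..n} (\<lambda>j. ev j - \<mu>) k"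
      unfolding isotropic_def using inj[unfolded inj_mat_iff[OF Z] all[symmetric]] 0
      by (intro exI[of _ "\<lambda>a j. Z $$ (j - 1, a)"] conjI)
  next
    assume "isotropic {1..n} (\<lambda>j. ev j - \<mu>) k"
    then obtain x where x: "\<forall>a<k. \<forall>b<k. (\<Sum>j = 1..n. (ev j - \<mu>) * cnj (x a j) * x b j) = 0"
      and li: "\<forall>c. (\<forall>j\<in>{1..n}. (\<Sum>a<k. c a * x a j) = 0) \<longrightarrow> (\<forall>a<k. c a = 0)"
      unfolding isotropic_def by blast
    define Z where "Z = mat n k (\<lambda>(i, a). x a (Suc i))"
    have Z: "Z \<in> carrier_mat n k" by (simp add: Z_def)
    have Zx: "Z $$ (j - 1, a) = x a j" if "j \<in> {1..n}" "a < k" for j a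
      using that by (auto simp: Z_def)
    have "inj_mat Z"
      unfolding inj_mat_iff[OF Z] all[symmetric] using li Zx by simp
    moreover have "\<forall>a<k. \<forall>b<k. (\<Sum>j = 1..n. (ev j - \<mu>) * cnj (Z $$ (j - 1, a)) * Z $$ (j - 1, b)) = 0"
      using x Zx by simp
    ultimately show "\<exists>X\<in>carrier_mat n k. inj_mat X \<and> mat_adjoint X * (A * X) = \<mu> \<cdot>\<^sub>m (mat_adjoint X * X)"
      using iff[OF Z] U(1) Z by (intro bexI[of _ "U * Z"]) auto
  qed
qed

theorem corollary2p4:
  fixes A :: "complex mat" and n k :: nat and ev :: "nat \<Rightarrow> complex"
  assumes "A \<in> carrier_mat n n"
    and "normal_mat A"
    and "char_poly A = (\<Prod>j = 1..n. [:- ev j, 1:])"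
    and "1 \<le> k" and "k \<le> n"
  shows "rank_numerical_range k A =
    (\<Inter>J \<in> {J. J \<subseteq> {1..n} \<and> card J = n - k + 1}. convex hull (ev ` J))"
proof (rule Set.set_eqI)
  fix \<mu>
  have shift: "0 \<in> convex hull ((\<lambda>j. ev j - \<mu>) ` J) \<longleftrightarrow> \<mu> \<in> convex hull (ev ` J)" for J
  proof -
    have "(\<lambda>j. ev j - \<mu>) ` J = (\<lambda>z. - \<mu> + z) ` ev ` J" by (simp add: image_image)
    then have "convex hull ((\<lambda>j. ev j - \<mu>) ` J) = (\<lambda>z. - \<mu> + z) ` (convex hull (ev ` J))"
      by (simp only: convex_hull_translation)
    then show ?thesis by force
  qed
  have "\<mu> \<in> rank_numerical_range k A \<longleftrightarrow> isotropic {1..n} (\<lambda>j. ev j - \<mu>) k"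
    by (rule rank_numerical_range_normal_iff_isotropic[OF assms(1-3)])
  also have "\<dots> \<longleftrightarrow> (\<forall>J. J \<subseteq> {1..n} \<and> card J = n - k + 1 \<longrightarrow> 0 \<in> convex hull ((\<lambda>j. ev j - \<mu>) ` J))"
    using isotropic_imp_hull[of "{1..n}" k] hull_imp_isotropic[of "{1..n}" k "\<lambda>j. ev j - \<mu>"] assms(4,5)
    by auto
  finally show "\<mu> \<in> rank_numerical_range k A \<longleftrightarrow>
      \<mu> \<in> (\<Inter>J \<in> {J. J \<subseteq> {1..n} \<and> card J = n - k + 1}. convex hull (ev ` J))"
    by (simp add: shift)
qed

end
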